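(* Let $M\subset\mathbb{R}^2$ be a positively oriented oval of length $L_M$, enclosing a region of area $A_M$. For $\lambda\in\mathbb{R}$ let $\widetilde{A}_{E_\lambda(M)}$ denote the oriented area of the affine $\lambda$-equidistant $E_\lambda(M)$. Then: (i) if $\lambda\in(0,\tfrac12)\cup(\tfrac12,1)$, then $$A_M-\frac{\lambda(1-\lambda)}{\pi}L_M^2\leqslant\widetilde{A}_{E_\lambda(M)}\leqslant(2\lambda-1)^2A_M;$$ (ii) if $\lambda=\tfrac12$, then $$A_M-\frac{L_M^2}{4\pi}\leqslant 2\widetilde{A}_{E_{1/2}(M)}\leqslant 0;$$ (iii) if $\lambda\in(-\infty,0)\cup(1,\infty)$, then $$(2\lambda-1)^2A_M\leqslant\widetilde{A}_{E_\lambda(M)}\leqslant A_M-\frac{\lambda(1-\lambda)}{\pi}L_M^2;$$ (iv) for every $\lambda\in\mathbb{R}\setminus\{0,\tfrac12,1\}$, $M$ is a curve of constant width if and only if $$\widetilde{A}_{E_\lambda(M)}=A_M-\frac{\lambda(1-\lambda)}{\pi}L_M^2;$$ (v) $M$ is a curve of constant width if and only if $$2\widetilde{A}_{E_{1/2}(M)}=A_M-\frac{L_M^2}{4\pi}.$$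
   Context: An oval is a smooth ($C^\infty$) regular closed simple curve in $\mathbb{R}^2$ that is convex, i.e. its signed curvature has constant sign (in particular it is nowhere zero). Fix an origin $O$ inside the oval $M$ and orient $M$ positively. For $\theta\in\mathbb{R}$ let $p(\theta)$ be the Minkowski support function of $M$: the oriented distance from $O$ to the tangent line of $M$ whose outer normal is $(\cos\theta,\sin\theta)$. It is $2\pi$-periodic, and $M$ is parametrized by $$\gamma(\theta)=\big(p(\theta)\cos\theta-p'(\theta)\sin\theta,\ p(\theta)\sin\theta+p'(\theta)\cos\theta\big),$$ with radius of curvature $\rho(\theta)=p(\theta)+p''(\theta)>0$. A parallel pair of $M$ is a pair of distinct points $a,b\in M$ at which the tangent lines to $M$ are parallel. For $\lambda\in\mathbb{R}$ the affine $\lambda$-equidistant is $E_\lambda(M)=\{\lambda a+(1-\lambda)b : a,b \text{ a parallel pair of } M\}$; the set $E_{1/2}(M)$ is called the Wigner caustic. The equidistant is parametrized by $\gamma_\lambda(\theta)=\lambda\gamma(\theta)+(1-\lambda)\gamma(\theta+\pi)$. The oriented area for $\lambda\neq\tfrac12$ is $$\widetilde{A}_{E_\lambda(M)}=\frac12\int_0^{2\pi}\big(\gamma_{\lambda,1}\gamma_{\lambda,2}'-\gamma_{\lambda,2}\gamma_{\lambda,1}'\big)\,d\theta,\qquad \gamma_\lambda=(\gamma_{\lambda,1},\gamma_{\lambda,2}).$$ For $\lambda=\tfrac12$ one has $\gamma_{1/2}(\theta+\pi)=\gamma_{1/2}(\theta)$, so $[0,2\pi]$ covers the Wigner caustic twice;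 the oriented area $\widetilde{A}_{E_{1/2}(M)}$ is the same integral taken over $[0,\pi]$ (one traversal). An oval has constant width if the distance between every pair of (distinct) parallel tangent lines is the same, i.e. $p(\theta)+p(\theta+\pi)$ is constant. *)

theory Defs
  imports "HOL-Complex_Analysis.Complex_Analysis"
begin

text \<open>
  The Euclidean plane is \<^typ>\<open>complex\<close> (with \<open>inner\<close> the Euclidean scalar product), the type for which
  \<^const>\<open>winding_number\<close> is available.  A closed curve is a 1-periodic map on the reals, so that it is
  a library path on \<open>{0..1}\<close> which also closes up smoothly.
\<close>

abbreviation velocity :: "(real \<Rightarrow> complex) \<Rightarrow> real \<Rightarrow> complex" where
  "velocity c \<equiv> (\<lambda>t. vector_derivative c (at t))"

definition smooth_curve :: "(real \<Rightarrow> complex) \<Rightarrow> bool" where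
  "smooth_curve c \<longleftrightarrow> (\<forall>k t. (velocity ^^ k) c differentiable (at t))"

text \<open>\<open>det (v, w) = Im (cnj v * w)\<close> for plane vectors \<open>v\<close>, \<open>w\<close>.\<close>

definition signed_curvature :: "(real \<Rightarrow> complex) \<Rightarrow> real \<Rightarrow> real" where
  "signed_curvature c t =
     Im (cnj (velocity c t) * velocity (velocity c) t) / norm (velocity c t) ^ 3"

definition oval :: "(real \<Rightarrow> complex) \<Rightarrow> bool" where
  "oval c \<longleftrightarrow>
     smooth_curve c \<and>
     (\<forall>t. velocity c t \<noteq> 0) \<and>
     (\<forall>t. c (t + 1) = c t) \<and>
     simple_path c \<and>
     ((\<forall>t. signed_curvature c t > 0) \<or> (\<forall>t. signed_curvature c t < 0))"

definition positively_oriented :: "(real \<Rightarrow> complex) \<Rightarrow> bool" where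
  "positively_oriented c \<longleftrightarrow> (\<forall>z \<in> inside (path_image c). winding_number c z = 1)"

definition curve_length :: "(real \<Rightarrow> complex) \<Rightarrow> real" where
  "curve_length c = integral {0..1} (\<lambda>t. norm (velocity c t))"

definition enclosed_area :: "(real \<Rightarrow> complex) \<Rightarrow> real" where
  "enclosed_area c = measure lebesgue (inside (path_image c))"

definition tangent_line :: "(real \<Rightarrow> complex) \<Rightarrow> real \<Rightarrow> complex set" where
  "tangent_line c t = range (\<lambda>s::real. c t + s *\<^sub>R velocity c t)"

text \<open>
  The unit vector \<open>u\<close> is the outer normal of the tangent line at \<open>c t\<close> if it is orthogonal to that
  line and the curve does not cross to the side of the line to which \<open>u\<close> points.
\<close>

definition outer_normal :: "(real \<Rightarrow> complex) \<Rightarrow> real \<Rightarrow> complex \<Rightarrow> bool" where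
  "outer_normal c t u \<longleftrightarrow>
     norm u = 1 \<and> inner (velocity c t) u = 0 \<and> (\<forall>x \<in> path_image c. inner (x - c t) u \<le> 0)"

text \<open>
  The oriented distance from \<open>q\<close> to the line through \<open>a\<close> with unit normal \<open>u\<close> is \<open>inner (a - q) u\<close>.
\<close>

definition support_function :: "(real \<Rightarrow> complex) \<Rightarrow> complex \<Rightarrow> real \<Rightarrow> real" where
  "support_function c q \<theta> =
     (THE h. \<exists>t. outer_normal c t (cis \<theta>) \<and> h = inner (c t - q) (cis \<theta>))"

text \<open>Here \<open>q\<close> is the origin of coordinates.\<close>

definition support_param :: "(real \<Rightarrow> complex) \<Rightarrow> complex \<Rightarrow> real \<Rightarrow> complex" where
  "support_param c q \<theta> =
     (let p = support_function c q in
       Complex (p \<theta> * cos \<theta> - deriv p \<theta> * sin \<theta>) (p \<theta> * sin \<theta> + deriv p \<theta> * cos \<theta>))"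

definition equidistant_param ::
    "(real \<Rightarrow> complex) \<Rightarrow> complex \<Rightarrow> real \<Rightarrow> real \<Rightarrow> complex" where
  "equidistant_param c q l \<theta> =
     l *\<^sub>R support_param c q \<theta> + (1 - l) *\<^sub>R support_param c q (\<theta> + pi)"

text \<open>
  For \<open>l = 1/2\<close> the parametrization is \<open>pi\<close>-periodic, and the area is that of a single traversal.
\<close>

definition equidistant_area :: "(real \<Rightarrow> complex) \<Rightarrow> complex \<Rightarrow> real \<Rightarrow> real" where
  "equidistant_area c q l =
     (let g = equidistant_param c q l in
       1/2 * integral {0..(if l = 1/2 then pi else 2 * pi)}
         (\<lambda>\<theta>. Re (g \<theta>) * Im (velocity g \<theta>) - Im (g \<theta>) * Re (velocity g \<theta>)))"

definition constant_width :: "(real \<Rightarrow> complex) \<Rightarrow> bool" where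
  "constant_width c \<longleftrightarrow>
     (\<exists>w. \<forall>s t. collinear {0, velocity c s, velocity c t} \<and> tangent_line c s \<noteq> tangent_line c t
        \<longrightarrow> setdist (tangent_line c s) (tangent_line c t) = w)"

end

theory Submission
  imports Defs
begin

text \<open>
Let \<open>p\<close> be the support function of the oval, \<open>p\<^sub>e\<close> and \<open>p\<^sub>o\<close> its even and odd parts under
\<open>x \<mapsto> x + pi\<close>.  The equidistant with parameter \<open>l\<close> has support function
\<open>l p(x) - (1 - l) p(x + pi) = (2 l - 1) p\<^sub>e + p\<^sub>o\<close>.  Twice the oriented area is the
integral of \<open>h (h + h'')\<close> for the respective support function \<open>h\<close>, a quadratic form for which
even and odd parts are orthogonal.  Writing \<open>E\<close> and \<open>N\<close> for its halved values at \<open>p\<^sub>e\<close>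
and \<open>p\<^sub>o\<close>, one finds area \<open>(2 l - 1)\<^sup>2 E + N\<close> for the equidistant and \<open>E + N\<close> for the
oval.  So the area of the equidistant exceeds \<open>(2 l - 1)\<^sup>2 A\<close> by \<open>4 l (1 - l) N\<close> and falls
short of \<open>A\<close> by \<open>4 l (1 - l) E\<close>.  (For \<open>l = 1/2\<close> a single traversal covers half a turn, which
halves the area.)

Everything thus follows from \<open>N \<le> 0\<close> and \<open>E \<le> L\<^sup>2 / (4 pi)\<close>, with equality in the
second case iff \<open>p\<^sub>e\<close> is constant, i.e. iff the oval has constant width
(lemmas \<open>odd_area_nonpos\<close> and \<open>even_area_bound\<close>).  Both are consequences of Wirtinger's
inequality for functions that vanish at the ends of an interval of length \<open>pi\<close>
(\<open>wirtinger_dirichlet\<close>): \<open>p\<^sub>o\<close> and \<open>p\<^sub>e - L / (2 pi)\<close> have zeros at distance \<open>pi\<close>.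

The geometric part connects a parametrized curve with its support function.  The decisive point is
that a simple closed curve of positive curvature turns only once; this is Hopf's Umlaufsatz, proved
by following the direction of chords (\<open>rotation_index_one\<close>).  It permits a parametrization by the
normal angle, from which convexity is read off (\<open>below_tangent\<close>).  The enclosed area is computed
by a change of variables to polar coordinates around an inside point (\<open>area_eq\<close>), the length by
Cauchy's formula (\<open>length_supp\<close>).
\<close>

section \<open>Integrals of periodic functions\<close>

lemma antiderivative_on_line:
  fixes f :: "real \<Rightarrow> 'a::euclidean_space"
  assumes "continuous_on UNIV f"
  obtains F where "\<And>x. (F has_vector_derivative f x) (at x)"
proof -
  have "\<exists>F. \<forall>x::real. -\<infinity> < ereal x \<longrightarrow> ereal x < \<infinity> \<longrightarrow> (F has_vector_derivative f x) (at x)"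
    by (rule einterval_antiderivative) (use assms in \<open>auto simp: continuous_on_eq_continuous_at\<close>)
  then obtain F where "\<forall>x::real. (F has_vector_derivative f x) (at x)" by auto
  then show thesis using that[of F] by simp
qed

lemma integral_eq_antiderivative_diff:
  fixes F :: "real \<Rightarrow> 'a::banach"
  assumes "\<And>x. (F has_vector_derivative f x) (at x)" "a \<le> b"
  shows "integral {a..b} f = F b - F a"
  by (intro integral_unique fundamental_theorem_of_calculus assms(2)
        has_vector_derivative_at_within[OF assms(1)])

lemma constant_if_derivative_zero:
  fixes F :: "real \<Rightarrow> 'a::real_normed_vector"
  assumes "\<And>x. (F has_vector_derivative 0) (at x)"
  shows "F x = F y"
  using has_vector_derivative_zero_constant[of UNIV F] assms
  by (metis UNIV_I convex_UNIV)

lemma has_vector_derivative_shift: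
  fixes F :: "real \<Rightarrow> 'a::real_normed_vector"
  assumes "\<And>x. (F has_vector_derivative f x) (at x)"
  shows "((\<lambda>x. F (x + T)) has_vector_derivative f (x + T)) (at x)"
proof -
  have "((F \<circ> (\<lambda>x. x + T)) has_vector_derivative 1 *\<^sub>R f (x + T)) (at x)"
    by (rule vector_diff_chain_at) (use assms in \<open>auto intro!: derivative_eq_intros\<close>)
  then show ?thesis by (simp add: o_def)
qed

text \<open>
For an antiderivative \<open>F\<close> of a periodic \<open>f\<close> the increment over one period does not depend on
the starting point, because its derivative is \<open>f (x + T) - f x\<close>.
\<close>

lemma integral_periodic_shift:
  fixes f :: "real \<Rightarrow> 'a::euclidean_space"
  assumes "continuous_on UNIV f" "\<And>x. f (x + T) = f x" "0 \<le> T"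
  shows "integral {a..a+T} f = integral {b..b+T} f"
proof -
  obtain F where F: "\<And>x. (F has_vector_derivative f x) (at x)"
    using antiderivative_on_line[OF assms(1)] by blast
  have "((\<lambda>x. F (x + T) - F x) has_vector_derivative 0) (at x)" for x
    using has_vector_derivative_diff[OF has_vector_derivative_shift[of F f T, OF F] F[of x]]
    by (simp add: assms(2))
  from constant_if_derivative_zero[of "\<lambda>x. F (x + T) - F x" a b, OF this]
  show ?thesis
    using integral_eq_antiderivative_diff[OF F] assms(3) by simp
qed

lemma integral_antiperiodic:
  fixes f :: "real \<Rightarrow> 'a::euclidean_space"
  assumes "continuous_on UNIV f" "\<And>x. f (x + T) = - f x" "0 \<le> T"
  shows "integral {a..a+2*T} f = 0"
proof -
  obtain F where F: "\<And>x. (F has_vector_derivative f x) (at x)"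
    using antiderivative_on_line[OF assms(1)] by blast
  have "((\<lambda>x. F (x + T) + F x) has_vector_derivative 0) (at x)" for x
    using has_vector_derivative_add[OF has_vector_derivative_shift[of F f T, OF F] F[of x]]
    by (simp add: assms(2))
  from constant_if_derivative_zero[of "\<lambda>x. F (x + T) + F x" "a+T" a, OF this]
  show ?thesis
    using integral_eq_antiderivative_diff[OF F, of a "a+2*T"] assms(3) 
    by (simp add: algebra_simps)
qed

lemma integral_two_periods:
  fixes f :: "real \<Rightarrow> real"
  assumes "continuous_on UNIV f" "\<And>x. f (x + T) = f x" "0 \<le> T"
  shows "integral {0..2*T} f = 2 * integral {0..T} f"
proof -
  have "integral {0..T} f + integral {T..2*T} f = integral {0..2*T} f"
    using assms(3)
    by (intro Henstock_Kurzweil_Integration.integral_combine integrable_continuous_real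
          continuous_on_subset[OF assms(1)]) auto
  moreover have "integral {T..T+T} f = integral {0..0+T} f"
    by (rule integral_periodic_shift[OF assms])
  ultimately show ?thesis by simp
qed

section \<open>Wirtinger's inequality on an interval of length pi\<close>

text \<open>
At a common zero of \<open>f\<close> and \<open>sin\<close> the quotient \<open>f / sin\<close> stays bounded, so that the
spare factor \<open>f\<close> decides.  This removes the boundary terms in Wirtinger's inequality.
\<close>

lemma square_times_cot_tendsto_zero:
  fixes f :: "real \<Rightarrow> real"
  assumes "(f has_real_derivative d) (at a)" "f a = 0" "sin a = 0"
  shows "((\<lambda>x. (f x)\<^sup>2 * cot x) \<longlongrightarrow> 0) (at a)"
proof -
  have c: "cos a \<noteq> 0" using assms(3) sin_zero_abs_cos_one by fastforce
  have 1: "((\<lambda>x. (f x - f a) / (x - a)) \<longlongrightarrow> d) (at a)"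
    using assms(1) by (simp add: has_field_derivative_iff)
  have "(sin has_real_derivative cos a) (at a)" by (rule DERIV_sin)
  then have 2: "((\<lambda>x. (sin x - sin a) / (x - a)) \<longlongrightarrow> cos a) (at a)"
    by (simp add: has_field_derivative_iff)
  have 3: "(f \<longlongrightarrow> 0) (at a)"
    using DERIV_isCont[OF assms(1)] assms(2) by (simp add: isCont_def)
  have 4: "(cos \<longlongrightarrow> cos a) (at a)" by (intro tendsto_intros)
  have "((\<lambda>x. f x * cos x * (((f x - f a) / (x - a)) / ((sin x - sin a) / (x - a))))
          \<longlongrightarrow> 0 * cos a * (d / cos a)) (at a)"
    by (intro tendsto_mult tendsto_divide 1 2 3 4 c)
  then have "((\<lambda>x. f x * cos x * (((f x - f a) / (x - a)) / ((sin x - sin a) / (x - a))))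
          \<longlongrightarrow> 0) (at a)" by simp
  then show ?thesis
  proof (rule Lim_transform_eventually)
    show "\<forall>\<^sub>F x in at a. f x * cos x * (((f x - f a) / (x - a)) / ((sin x - sin a) / (x - a)))
            = (f x)\<^sup>2 * cot x"
      unfolding eventually_at_filter
      by (rule always_eventually) (auto simp: assms cot_def power2_eq_square)
  qed
qed

text \<open>
The reason is the pointwise identity
\<open>f (f + f'') = (f f' - f\<^sup>2 cot)' - (f' - f cot)\<^sup>2\<close>: the bracket under the
derivative vanishes at both ends of the interval, so the integral is minus that of a square.  If
it is zero, then \<open>f' = f cot\<close> inside the interval, i.e. \<open>f / sin\<close> is constant there.
\<close>

lemma wirtinger_dirichlet:
  fixes f f1 f2 :: "real \<Rightarrow> real"
  assumes f: "\<And>x. (f has_real_derivative f1 x) (at x)"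
    and f1: "\<And>x. (f1 has_real_derivative f2 x) (at x)"
    and f2: "continuous_on UNIV f2"
    and zero: "f 0 = 0" "f pi = 0"
  shows "integral {0..pi} (\<lambda>x. f x * (f x + f2 x)) \<le> 0"
    and "integral {0..pi} (\<lambda>x. f x * (f x + f2 x)) = 0 \<Longrightarrow> \<exists>C. \<forall>x\<in>{0..pi}. f x = C * sin x"
proof -
  let ?I = "integral {0..pi} (\<lambda>x. f x * (f x + f2 x))"
  have cf: "isCont f x" "isCont f1 x" "isCont f2 x" for x
    using f f1 f2 by (auto intro: DERIV_isCont simp: continuous_on_eq_continuous_at)
  define G where "G = (\<lambda>x. f x * f1 x - (f x)\<^sup>2 * cot x)"
  define k where "k = (\<lambda>x. (f1 x - f x * cot x)\<^sup>2)"
  have sin_pos: "sin x \<noteq> 0" if "x \<in> {0<..<pi}" for x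
    using that sin_gt_zero by fastforce
  have "isCont G x" if "x \<in> {0..pi}" for x
  proof (cases "x \<in> {0<..<pi}")
    case True
    then show ?thesis unfolding G_def using sin_pos[OF True]
      by (intro continuous_intros cf) auto
  next
    case False
    then have x: "x = 0 \<or> x = pi" using that by auto
    have "((\<lambda>x. f x * f1 x) \<longlongrightarrow> f x * f1 x) (at x)"
      using cf by (intro tendsto_mult) (auto simp: isCont_def)
    then have "((\<lambda>x. f x * f1 x) \<longlongrightarrow> 0) (at x)" using x zero by auto
    moreover have "((\<lambda>x. (f x)\<^sup>2 * cot x) \<longlongrightarrow> 0) (at x)"
      using square_times_cot_tendsto_zero[OF f[of x]] x zero by auto
    ultimately have "(G \<longlongrightarrow> 0 - 0) (at x)" unfolding G_def by (rule tendsto_diff)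
    moreover have "G x = 0" using x zero by (auto simp: G_def)
    ultimately show ?thesis by (simp add: isCont_def)
  qed
  then have contG: "continuous_on {0..pi} G"
    by (simp add: continuous_at_imp_continuous_on)
  \<comment> \<open>the identity that the whole inequality rests on\<close>
  have derG: "(G has_real_derivative f x * (f x + f2 x) + k x) (at x)" if "x \<in> {0<..<pi}" for x
  proof -
    have s: "sin x \<noteq> 0" by (rule sin_pos[OF that])
    have "(G has_real_derivative (f1 x * f1 x + f2 x * f x) -
         ((f1 x * f x + f1 x * f x) * cot x + (- inverse ((sin x)\<^sup>2)) * (f x)\<^sup>2)) (at x)"
      unfolding G_def power2_eq_square[of "f _"]
      by (intro DERIV_diff DERIV_mult f f1 DERIV_cot s)
    moreover have "inverse ((sin x)\<^sup>2) = 1 + (cot x)\<^sup>2"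
      using s sin_cos_squared_add[of x] by (simp add: cot_def field_simps power_divide)
    ultimately show ?thesis
      by (simp add: k_def power2_eq_square algebra_simps)
  qed
  have "((\<lambda>x. f x * (f x + f2 x) + k x) has_integral (G pi - G 0)) {0..pi}"
    by (rule fundamental_theorem_of_calculus_interior)
       (use contG derG in \<open>auto simp: has_real_derivative_iff_has_vector_derivative\<close>)
  moreover have "G pi - G 0 = 0" by (simp add: G_def zero)
  ultimately have H: "((\<lambda>x. f x * (f x + f2 x) + k x) has_integral 0) {0..pi}" by simp
  have "(\<lambda>x. f x * (f x + f2 x)) integrable_on {0..pi}"
    using f2 by (intro integrable_continuous_real continuous_intros)
      (auto intro!: continuous_at_imp_continuous_on cf)
  then have I: "((\<lambda>x. f x * (f x + f2 x)) has_integral ?I) {0..pi}" by blast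
  have K: "(k has_integral (0 - ?I)) {0..pi}"
    using has_integral_diff[OF H I] by simp
  have k0: "k x \<ge> 0" for x by (simp add: k_def)
  show "?I \<le> 0"
    using has_integral_nonneg[OF K] k0 by auto
  assume "?I = 0"
  with K have K0: "(k has_integral 0) {0..pi}" by simp
  \<comment> \<open>\<open>k\<close> is known to be continuous only in the open interval, hence the detour over \<open>{a..b}\<close>\<close>
  have kz: "k x = 0" if x: "x \<in> {0<..<pi}" for x
  proof -
    obtain a b where ab: "0 < a" "a < x" "x < b" "b < pi"
      using x dense[of 0 x] dense[of x pi] by auto
    have sub: "{a..b} \<subseteq> {0..pi}" using ab by auto
    have cont: "continuous_on {a..b} k"
      unfolding k_def
      by (intro continuous_at_imp_continuous_on ballI continuous_intros cf)
         (use ab sin_pos in auto)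
    have "integral {a..b} k \<le> integral {0..pi} k"
      by (rule integral_subset_le[OF sub])
         (use K0 k0 cont in \<open>auto intro: integrable_continuous_real\<close>)
    also have "\<dots> = 0" using K0 by blast
    finally have "integral {a..b} k = 0"
      using Henstock_Kurzweil_Integration.integral_nonneg[OF integrable_continuous_real[OF cont]] k0
      by (metis order_antisym)
    then have "(k has_integral 0) (cbox a b)"
      using integrable_continuous_real[OF cont] by (simp add: has_integral_integrable_integral)
    then show ?thesis
      by (intro has_integral_0_cbox_imp_0[of a b k x]) (use cont ab k0 in auto)
  qed
  define C where "C = f (pi/2)"
  have der0: "((\<lambda>x. f x / sin x) has_real_derivative 0) (at x within {0<..<pi})"
    if x: "x \<in> {0<..<pi}" for x
  proof -
    have s: "sin x \<noteq> 0" by (rule sin_pos[OF x])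
    have "f1 x = f x * cot x" using kz[OF x] by (simp add: k_def)
    then have "(f1 x * sin x - f x * cos x) / (sin x * sin x) = 0"
      using s by (simp add: cot_def)
    then have "((\<lambda>x. f x / sin x) has_real_derivative 0) (at x)"
      using DERIV_divide[OF f[of x] DERIV_sin s] by metis
    then show ?thesis by (rule has_field_derivative_at_within)
  qed
  have "f x = C * sin x" if x: "x \<in> {0<..<pi}" for x
  proof -
    have "\<exists>c. \<forall>x\<in>{0<..<pi}. f x / sin x = c"
      by (rule has_field_derivative_zero_constant) (use der0 in auto)
    then obtain c where c: "\<And>y. y \<in> {0<..<pi} \<Longrightarrow> f y / sin y = c" by blast
    have "f x / sin x = f (pi/2) / sin (pi/2)"
      using c[OF x] c[of "pi/2"] by simp
    then show ?thesis using sin_pos[OF x] by (simp add: C_def field_simps)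
  qed
  then have "f x = C * sin x" if "x \<in> {0..pi}" for x
    using zero that by (cases "x = 0 \<or> x = pi") auto
  then show "\<exists>C. \<forall>x\<in>{0..pi}. f x = C * sin x" by blast
qed


section \<open>Area functionals of the even and odd parts of a support function\<close>

lemma integral_translate:
  fixes f :: "real \<Rightarrow> 'a::euclidean_space"
  assumes "continuous_on UNIV f" "0 \<le> T"
  shows "integral {a..a+T} f = integral {0..T} (\<lambda>x. f (x + a))"
proof -
  obtain F where F: "\<And>x. (F has_vector_derivative f x) (at x)"
    using antiderivative_on_line[OF assms(1)] by blast
  show ?thesis
    using integral_eq_antiderivative_diff[OF F, of a "a+T"] assms(2)
      integral_eq_antiderivative_diff[OF has_vector_derivative_shift[of F f a, OF F], of 0 T]
    by (simp add: add.commute)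
qed

lemma periodic_int_multiple:
  fixes f :: "real \<Rightarrow> 'a"
  assumes "\<And>x. f (x + T) = f x"
  shows "f (x + of_int k * T) = f x"
proof -
  interpret periodic_fun_simple f T by standard (rule assms)
  show ?thesis by (rule plus_of_int)
qed

lemma periodic_reduce:
  fixes a T x :: real
  assumes "T > 0"
  obtains k :: int where "a \<le> x + of_int k * T" "x + of_int k * T < a + T"
proof -
  define k where "k = - \<lfloor>(x - a) / T\<rfloor>"
  have "of_int \<lfloor>(x - a) / T\<rfloor> \<le> (x - a) / T" "(x - a) / T < of_int \<lfloor>(x - a) / T\<rfloor> + 1"
    by linarith+
  then have "of_int \<lfloor>(x - a) / T\<rfloor> * T \<le> x - a" "x - a < (of_int \<lfloor>(x - a) / T\<rfloor> + 1) * T"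
    using assms pos_le_divide_eq pos_divide_less_eq by blast+
  then have "a \<le> x + of_int k * T" "x + of_int k * T < a + T"
    by (simp_all add: k_def algebra_simps)
  then show thesis by (rule that)
qed

text \<open>
The form in which Wirtinger's inequality gets applied: the zeros sit at an unknown place \<open>a\<close>, but
periodicity of the integrand allows the integral to be taken over a fixed interval.
\<close>

lemma wirtinger_translated:
  fixes f f1 f2 :: "real \<Rightarrow> real"
  assumes f: "\<And>x. (f has_real_derivative f1 x) (at x)"
    and f1: "\<And>x. (f1 has_real_derivative f2 x) (at x)"
    and f2: "continuous_on UNIV f2"
    and zero: "f a = 0" "f (a + pi) = 0"
    and per: "\<And>x. f (x + pi) * (f (x + pi) + f2 (x + pi)) = f x * (f x + f2 x)"
  shows "integral {0..pi} (\<lambda>x. f x * (f x + f2 x)) \<le> 0"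
    and "integral {0..pi} (\<lambda>x. f x * (f x + f2 x)) = 0
           \<Longrightarrow> \<exists>C. \<forall>x\<in>{0..pi}. f (x + a) = C * sin x"
proof -
  have cont: "continuous_on UNIV f" "continuous_on UNIV f1"
    using f f1 by (auto intro!: continuous_at_imp_continuous_on DERIV_isCont)
  then have contF: "continuous_on UNIV (\<lambda>x. f x * (f x + f2 x))"
    by (intro continuous_intros f2)
  have "integral {0..pi} (\<lambda>x. f x * (f x + f2 x)) = integral {0..0+pi} (\<lambda>x. f x * (f x + f2 x))"
    by simp
  also have "\<dots> = integral {a..a+pi} (\<lambda>x. f x * (f x + f2 x))"
    by (rule integral_periodic_shift[OF contF]) (use per in auto)
  also have "\<dots> = integral {0..pi} (\<lambda>x. f (x + a) * (f (x + a) + f2 (x + a)))"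
    by (rule integral_translate[OF contF]) simp
  finally have eq: "integral {0..pi} (\<lambda>x. f x * (f x + f2 x)) = \<dots>" .
  have d: "((\<lambda>x. f (x + a)) has_real_derivative f1 (x + a)) (at x)"
    "((\<lambda>x. f1 (x + a)) has_real_derivative f2 (x + a)) (at x)" for x
    by (rule DERIV_shift[THEN iffD1, OF f] DERIV_shift[THEN iffD1, OF f1])+
  have c: "continuous_on UNIV (\<lambda>x. f2 (x + a))"
    by (rule continuous_on_compose2[OF f2]) (auto intro: continuous_intros)
  have z: "f (0 + a) = 0" "f (pi + a) = 0" using zero by (simp_all add: add.commute)
  show "integral {0..pi} (\<lambda>x. f x * (f x + f2 x)) \<le> 0"
    unfolding eq by (rule wirtinger_dirichlet(1)[OF d c z])
  show "\<exists>C. \<forall>x\<in>{0..pi}. f (x + a) = C * sin x"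
    if "integral {0..pi} (\<lambda>x. f x * (f x + f2 x)) = 0"
    using that unfolding eq by (rule wirtinger_dirichlet(2)[OF d c z])
qed

text \<open>
Antipodal normals \<open>x\<close> and \<open>x + pi\<close> belong to parallel tangents.  For a support function the
even part is half of the width of the curve in direction \<open>x\<close>; it is constant exactly for curves
of constant width.
\<close>

definition even_part :: "(real \<Rightarrow> real) \<Rightarrow> real \<Rightarrow> real" where
  "even_part f x = (f x + f (x + pi)) / 2"

definition odd_part :: "(real \<Rightarrow> real) \<Rightarrow> real \<Rightarrow> real" where
  "odd_part f x = (f x - f (x + pi)) / 2"

lemma continuous_on_parts:
  assumes "continuous_on UNIV f"
  shows "continuous_on A (even_part f)" "continuous_on A (odd_part f)"
proof -
  have "continuous_on UNIV (\<lambda>x. f (x + pi))"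
    by (rule continuous_on_compose2[OF assms]) (auto intro: continuous_intros)
  then have "continuous_on UNIV (even_part f)" "continuous_on UNIV (odd_part f)"
    unfolding even_part_def odd_part_def by (auto intro!: continuous_intros assms)
  then show "continuous_on A (even_part f)" "continuous_on A (odd_part f)"
    by (auto intro: continuous_on_subset)
qed

lemma parts_has_real_derivative:
  assumes "\<And>x. (f has_real_derivative f' x) (at x)"
  shows "(even_part f has_real_derivative even_part f' x) (at x)"
    "(odd_part f has_real_derivative odd_part f' x) (at x)"
proof -
  have "((\<lambda>x. f (x + pi)) has_real_derivative f' (x + pi)) (at x)"
    by (rule DERIV_shift[THEN iffD1, OF assms])
  then show "(even_part f has_real_derivative even_part f' x) (at x)"
    "(odd_part f has_real_derivative odd_part f' x) (at x)"
    unfolding even_part_def odd_part_def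
    by (auto intro!: derivative_eq_intros assms)
qed

text \<open>
Only analysis enters in this locale: a \<open>2 * pi\<close>-periodic function of class \<open>C\<^sup>2\<close> with its first
two derivatives.  For a support function \<open>p + p2\<close> is the radius of curvature, and the integral of
\<open>p * (p + p2)\<close> over a full turn is twice the oriented area.
\<close>

locale support_profile =
  fixes p p1 p2 :: "real \<Rightarrow> real"
  assumes p: "\<And>x. (p has_real_derivative p1 x) (at x)"
    and p1: "\<And>x. (p1 has_real_derivative p2 x) (at x)"
    and p2: "continuous_on UNIV p2"
    and p_per: "\<And>x. p (x + 2 * pi) = p x"
    and p2_per: "\<And>x. p2 (x + 2 * pi) = p2 x"
begin

text \<open>
The oriented areas belonging to the two parts of \<open>p\<close>.  The integrands have period \<open>pi\<close>, so
the factor \<open>1/2\<close> of the area formula is absorbed by integrating over half a turn.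
\<close>

definition even_area :: real where
  "even_area = integral {0..pi} (\<lambda>x. even_part p x * (even_part p x + even_part p2 x))"

definition odd_area :: real where
  "odd_area = integral {0..pi} (\<lambda>x. odd_part p x * (odd_part p x + odd_part p2 x))"

lemma cont_p: "continuous_on A p" and cont_p2: "continuous_on A p2"
  using continuous_on_subset[OF p2, of A]
  by (auto intro!: continuous_at_imp_continuous_on[of A p] DERIV_isCont[OF p])

lemma p1_per: "p1 (x + 2 * pi) = p1 x"
proof -
  have "((\<lambda>x. p (x + 2 * pi)) has_real_derivative p1 (x + 2 * pi)) (at x)"
    by (rule DERIV_shift[THEN iffD1, OF p])
  then show ?thesis using p[of x] DERIV_unique by (simp add: p_per)
qed

lemma parts_shift:
  "even_part p (x + pi) = even_part p x" "odd_part p (x + pi) = - odd_part p x"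
  "even_part p2 (x + pi) = even_part p2 x" "odd_part p2 (x + pi) = - odd_part p2 x"
  "even_part p1 (x + pi) = even_part p1 x"
  using p_per[of x] p2_per[of x] p1_per[of x]
  by (auto simp: even_part_def odd_part_def add.assoc field_simps)

lemma parts_integrable:
  "(\<lambda>x. even_part p x * (even_part p x + even_part p2 x)) integrable_on {a..b}"
  "(\<lambda>x. odd_part p x * (odd_part p x + odd_part p2 x)) integrable_on {a..b}"
  "(\<lambda>x. even_part p x * (odd_part p x + odd_part p2 x)
      + odd_part p x * (even_part p x + even_part p2 x)) integrable_on {a..b}"
  by (intro integrable_continuous_real continuous_intros continuous_on_parts cont_p cont_p2)+

text \<open>
Here \<open>l * p x - (1 - l) * p (x + pi)\<close>, the support function of the equidistant, is
\<open>2 * l - 1\<close> times the even part plus the odd part.  The mixed products change sign under half a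
turn and cancel in a full turn, so that only the two pure areas remain.
\<close>

lemma equidistant_integral:
  "integral {0..2*pi} (\<lambda>x. (l * p x - (1 - l) * p (x + pi)) *
      ((l * p x - (1 - l) * p (x + pi)) + (l * p2 x - (1 - l) * p2 (x + pi))))
     = 2 * ((2 * l - 1)\<^sup>2 * even_area + odd_area)"
proof -
  let ?E = "\<lambda>x. even_part p x * (even_part p x + even_part p2 x)"
  let ?O = "\<lambda>x. odd_part p x * (odd_part p x + odd_part p2 x)"
  let ?M = "\<lambda>x. even_part p x * (odd_part p x + odd_part p2 x)
      + odd_part p x * (even_part p x + even_part p2 x)"
  have "l * p x - (1 - l) * p (x + pi) = (2 * l - 1) * even_part p x + odd_part p x"
    "l * p2 x - (1 - l) * p2 (x + pi) = (2 * l - 1) * even_part p2 x + odd_part p2 x" for x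
    by (simp_all add: even_part_def odd_part_def field_simps)
  then have "integral {0..2*pi} (\<lambda>x. (l * p x - (1 - l) * p (x + pi)) *
      ((l * p x - (1 - l) * p (x + pi)) + (l * p2 x - (1 - l) * p2 (x + pi))))
    = integral {0..2*pi} (\<lambda>x. ((2 * l - 1)\<^sup>2 * ?E x + ?O x) + (2 * l - 1) * ?M x)"
    by (intro integral_cong) (simp only:, simp add: power2_eq_square algebra_simps)
  also have "\<dots> = (2 * l - 1)\<^sup>2 * integral {0..2*pi} ?E + integral {0..2*pi} ?O
     + (2 * l - 1) * integral {0..2*pi} ?M"
    by (simp add: integral_add integrable_add parts_integrable integrable_on_mult_right)
  also have "integral {0..2*pi} ?E = 2 * even_area" unfolding even_area_def
    by (intro integral_two_periods continuous_intros continuous_on_parts cont_p cont_p2)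
       (simp_all add: parts_shift)
  also have "integral {0..2*pi} ?O = 2 * odd_area" unfolding odd_area_def
    by (intro integral_two_periods continuous_intros continuous_on_parts cont_p cont_p2)
       (simp_all add: parts_shift algebra_simps)
  also have "integral {0..0+2*pi} ?M = 0"
    by (intro integral_antiperiodic continuous_intros continuous_on_parts cont_p cont_p2)
       (simp_all add: parts_shift algebra_simps)
  then have "integral {0..2*pi} ?M = 0" by simp
  finally show ?thesis by (simp add: algebra_simps)
qed

lemma wigner_integral:
  "integral {0..pi} (\<lambda>x. (1/2 * p x - (1 - 1/2) * p (x + pi)) *
      ((1/2 * p x - (1 - 1/2) * p (x + pi)) + (1/2 * p2 x - (1 - 1/2) * p2 (x + pi))))
     = odd_area"
  unfolding odd_area_def by (intro integral_cong) (simp add: odd_part_def field_simps)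

lemma integral_p: "integral {0..2*pi} p = 2 * integral {0..pi} (even_part p)"
proof -
  have "integral {0..pi} p + integral {pi..2*pi} p = integral {0..2*pi} p"
    by (intro Henstock_Kurzweil_Integration.integral_combine integrable_continuous_real cont_p) auto
  moreover have "integral {pi..pi+pi} p = integral {0..pi} (\<lambda>x. p (x + pi))"
    by (rule integral_translate[OF cont_p]) simp
  moreover have "continuous_on {0..pi} (\<lambda>x. p (x + pi))"
    by (rule continuous_on_compose2[OF cont_p[of UNIV]]) (auto intro: continuous_intros)
  then have "integral {0..pi} (even_part p)
      = (integral {0..pi} p + integral {0..pi} (\<lambda>x. p (x + pi))) / 2"
    unfolding even_part_def
    by (simp add: integral_add integrable_continuous_real cont_p)
  ultimately show ?thesis by simp
qed

text \<open>
An odd part takes opposite values at antipodal points, so it has a zero \<open>a\<close> and then also the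
zero \<open>a + pi\<close>: Wirtinger's inequality applies to it directly.
\<close>

lemma odd_area_nonpos: "odd_area \<le> 0"
proof -
  have "\<exists>a. odd_part p a = 0"
  proof -
    have "odd_part p (0 + pi) = - odd_part p 0" by (rule parts_shift)
    then have "odd_part p 0 \<le> 0 \<and> 0 \<le> odd_part p pi \<or> odd_part p pi \<le> 0 \<and> 0 \<le> odd_part p 0"
      by auto
    then show ?thesis
      using IVT'[of "odd_part p" 0 0 pi] IVT2'[of "odd_part p" pi 0 0]
        continuous_on_parts(2)[OF cont_p] by fastforce
  qed
  then obtain a where a: "odd_part p a = 0" by blast
  have a': "odd_part p (a + pi) = 0" using a by (simp add: parts_shift)
  show ?thesis unfolding odd_area_def
    by (rule wirtinger_translated(1)[OF parts_has_real_derivative(2)[OF p]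
          parts_has_real_derivative(2)[OF p1] continuous_on_parts(2)[OF cont_p2] a a'])
       (simp add: parts_shift algebra_simps)
qed

text \<open>
The even part minus its mean value \<open>m\<close> has integral zero over a period \<open>pi\<close>, hence a zero, and
by periodicity zeros at distance \<open>pi\<close>.  Wirtinger's inequality bounds the area of the difference
by zero, and the mean itself contributes the isoperimetric value \<open>pi * m\<^sup>2\<close>.  In the case of
equality the difference is \<open>C * sin\<close> on an interval of length \<open>pi\<close>, where \<open>sin\<close> has a
positive integral; mean zero forces \<open>C = 0\<close>.
\<close>

lemma even_area_bound:
  "even_area \<le> (integral {0..2*pi} p)\<^sup>2 / (4 * pi)"
  "even_area = (integral {0..2*pi} p)\<^sup>2 / (4 * pi) \<longleftrightarrow> (\<exists>w. \<forall>x. p x + p (x + pi) = w)"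
proof -
  define m where "m = integral {0..pi} (even_part p) / pi"
  define f where "f = (\<lambda>x. even_part p x - m)"
  let ?f1 = "even_part p1" and ?f2 = "even_part p2"
  have f: "(f has_real_derivative ?f1 x) (at x)" for x
    unfolding f_def by (auto intro!: derivative_eq_intros parts_has_real_derivative p)
  have f1: "(?f1 has_real_derivative ?f2 x) (at x)" for x
    by (rule parts_has_real_derivative[OF p1])
  have f2: "continuous_on UNIV ?f2" by (rule continuous_on_parts[OF cont_p2])
  have fper: "f (x + pi) = f x" for x by (simp add: f_def parts_shift)
  have contf: "continuous_on A f" for A
    unfolding f_def by (intro continuous_intros continuous_on_parts cont_p)
  have int_f: "integral {0..pi} f = 0"
    unfolding f_def
    by (simp add: integral_diff integrable_continuous_real continuous_on_parts cont_p m_def)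
  have "\<exists>a. f a = 0"
  proof -
    obtain F where F: "\<And>x. (F has_vector_derivative f x) (at x)"
      using antiderivative_on_line[OF contf] by blast
    then have F': "(F has_real_derivative f x) (at x)" for x
      by (simp add: has_real_derivative_iff_has_vector_derivative)
    have "F pi - F 0 = 0"
      using integral_eq_antiderivative_diff[OF F, of 0 pi] int_f by simp
    moreover obtain z where "F pi - F 0 = (pi - 0) * f z"
      using MVT2[of 0 pi F f] F' by auto
    ultimately show ?thesis by auto
  qed
  then obtain a where a: "f a = 0" by blast
  let ?W = "integral {0..pi} (\<lambda>x. f x * (f x + ?f2 x))"
  note wirt = wirtinger_translated[of f ?f1 ?f2 a, OF f f1 f2 a]
  have W: "?W \<le> 0" "?W = 0 \<Longrightarrow> \<exists>C. \<forall>x\<in>{0..pi}. f (x + a) = C * sin x"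
    by (rule wirt; simp add: a fper parts_shift)+
  have int_f2: "(?f2 has_integral 0) {0..pi}"
  proof -
    have "(?f2 has_integral (?f1 pi - ?f1 0)) {0..pi}"
      by (rule fundamental_theorem_of_calculus)
         (auto simp: has_real_derivative_iff_has_vector_derivative[symmetric]
               intro: has_field_derivative_at_within f1)
    then show ?thesis using parts_shift(5)[of 0] by simp
  qed
  have E: "even_area = ?W + pi * m\<^sup>2"
  proof -
    have mm: "((\<lambda>x. m\<^sup>2) has_integral pi * m\<^sup>2) {0..pi}"
      using has_integral_const_real[of "m\<^sup>2" 0 pi] by simp
    have "((\<lambda>x. f x * (f x + ?f2 x) + (m * (2 * f x + ?f2 x) + m\<^sup>2)) has_integral
            (?W + (m * (2 * 0 + 0) + pi * m\<^sup>2))) {0..pi}"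
      by (intro has_integral_add has_integral_mult_right int_f2 mm
            integrable_integral integrable_continuous_real continuous_intros contf
            continuous_on_parts cont_p2)
         (use int_f contf in \<open>metis integrable_continuous_real integrable_integral\<close>)
    moreover have "f x * (f x + ?f2 x) + (m * (2 * f x + ?f2 x) + m\<^sup>2)
        = even_part p x * (even_part p x + ?f2 x)" for x
      by (simp add: f_def power2_eq_square algebra_simps)
    ultimately show ?thesis
      unfolding even_area_def by (simp add: integral_unique)
  qed
  have L: "(integral {0..2*pi} p)\<^sup>2 / (4 * pi) = pi * m\<^sup>2"
    unfolding integral_p m_def by (simp add: field_simps power2_eq_square)
  show "even_area \<le> (integral {0..2*pi} p)\<^sup>2 / (4 * pi)"
    using W(1) unfolding L E by simp
  show "even_area = (integral {0..2*pi} p)\<^sup>2 / (4 * pi) \<longleftrightarrow> (\<exists>w. \<forall>x. p x + p (x + pi) = w)"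
  proof
    assume "even_area = (integral {0..2*pi} p)\<^sup>2 / (4 * pi)"
    then have "?W = 0" unfolding L E by simp
    then obtain C where C: "\<And>x. x \<in> {0..pi} \<Longrightarrow> f (x + a) = C * sin x" using W(2) by blast
    have "0 = integral {0..0+pi} f" using int_f by simp
    also have "\<dots> = integral {a..a+pi} f"
      by (rule integral_periodic_shift[OF contf]) (auto simp: fper)
    also have "\<dots> = integral {0..pi} (\<lambda>x. f (x + a))"
      by (rule integral_translate[OF contf]) simp
    also have "\<dots> = integral {0..pi} (\<lambda>x. C * sin x)"
      by (rule integral_cong) (rule C)
    also have "\<dots> = (\<lambda>x. - C * cos x) pi - (\<lambda>x. - C * cos x) 0"
      by (rule integral_eq_antiderivative_diff)
         (auto intro!: derivative_eq_intros
            simp: has_real_derivative_iff_has_vector_derivative[symmetric])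
    finally have "C = 0" by simp
    have "f x = 0" for x
    proof -
      obtain k :: int where "a \<le> x + of_int k * pi" "x + of_int k * pi < a + pi"
        using periodic_reduce[of pi a x] by auto
      then show ?thesis
        using C[of "x + of_int k * pi - a"] \<open>C = 0\<close> periodic_int_multiple[of f pi x k, OF fper]
        by simp
    qed
    then have em: "even_part p x = m" for x by (simp add: f_def)
    have "p x + p (x + pi) = 2 * m" for x
      using em[of x] unfolding even_part_def by simp
    then show "\<exists>w. \<forall>x. p x + p (x + pi) = w" by blast
  next
    assume "\<exists>w. \<forall>x. p x + p (x + pi) = w"
    then obtain w where "\<forall>x. p x + p (x + pi) = w" by blast
    then have w: "even_part p x = w / 2" for x by (simp add: even_part_def)
    then have "even_part p = (\<lambda>x. w / 2)" by (rule ext)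
    then have "m = w / 2" by (simp add: m_def)
    then have "f = (\<lambda>x. 0)" using w by (auto simp: f_def)
    then show "even_area = (integral {0..2*pi} p)\<^sup>2 / (4 * pi)" unfolding L E by simp
  qed
qed

end


section \<open>Closed curves of positive curvature turn exactly once\<close>

text \<open>
A path in the closed upper half plane without the origin that leads from the positive to the
negative real axis gains exactly \<open>pi\<close> of argument: every other gain would carry a continuous
argument \<open>h\<close> through an interval on which \<open>sin\<close> is negative.
\<close>

lemma phase_gain_upper_half_plane:
  fixes h :: "real \<Rightarrow> real"
  assumes cont: "continuous_on {0..1} h"
    and ends: "cos (h 0) = 1" "cos (h 1) = -1"
    and upper: "\<And>x. x \<in> {0..1} \<Longrightarrow> sin (h x) \<ge> 0"
  shows "h 1 = h 0 + pi"
proof -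
  obtain n :: int where n: "h 0 = (2 * pi) * of_int n"
    using ends(1) cos_one_2pi_int by (metis mult.assoc mult.commute)
  define u where "u = (\<lambda>x. h x - h 0)"
  have trig: "sin (u x) = sin (h x)" "cos (u x) = cos (h x)" for x
    unfolding u_def n by (simp_all only: sin_diff cos_diff sin_int_2pin cos_int_2pin)
  have contu: "continuous_on {0..1} u" unfolding u_def by (intro continuous_intros cont)
  have up: "sin (u x) \<ge> 0" if "x \<in> {0..1}" for x using upper[OF that] by (simp add: trig)
  have u0: "u 0 = 0" by (simp add: u_def)
  have "u 1 \<le> pi"
  proof (rule ccontr)
    assume "\<not> u 1 \<le> pi"
    define v where "v = min (u 1) (3/2 * pi)"
    have v: "pi < v" "v < 2 * pi" "v \<le> u 1" using \<open>\<not> u 1 \<le> pi\<close> pi_gt_zero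
      by (auto simp: v_def min_less_iff_disj)
    obtain x where "x \<in> {0..1}" "u x = v"
      using IVT'[of u 0 v 1] contu u0 v by auto
    then show False using up[of x] sin_lt_zero[of v] v by simp
  qed
  moreover have "u 1 \<ge> 0"
  proof (rule ccontr)
    assume "\<not> u 1 \<ge> 0"
    define v where "v = max (u 1) (- pi/2)"
    have v: "- pi < v" "v < 0" "u 1 \<le> v" using \<open>\<not> u 1 \<ge> 0\<close> pi_gt_zero
      by (auto simp: v_def less_max_iff_disj)
    obtain x where "x \<in> {0..1}" "u x = v"
      using IVT2'[of u 1 v 0] contu u0 v by auto
    then show False using up[of x] sin_gt_zero[of "- v"] v by simp
  qed
  ultimately have "u 1 = pi"
    using ends(2) trig(2)[of 1] cos_inj_pi[of "u 1" pi] by simp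
  then show ?thesis by (simp add: u_def)
qed

lemma vector_derivative_Re_Im:
  assumes "(f has_vector_derivative f') F"
  shows "((\<lambda>t. Re (f t)) has_real_derivative Re f') F"
    "((\<lambda>t. Im (f t)) has_real_derivative Im f') F"
  using bounded_linear.has_vector_derivative[OF bounded_linear_Re assms]
    bounded_linear.has_vector_derivative[OF bounded_linear_Im assms]
  by (simp_all add: has_real_derivative_iff_has_vector_derivative)

text \<open>
The derivatives are parameters, so that the same curve travelled backwards is an instance without
computing its velocity.  This reversal also reduces negative curvature to the positive curvature
that the locale assumes.
\<close>

locale convex_loop =
  fixes c c1 c2 :: "real \<Rightarrow> complex"
  assumes c: "\<And>t. (c has_vector_derivative c1 t) (at t)"
    and c1: "\<And>t. (c1 has_vector_derivative c2 t) (at t)"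
    and c2: "continuous_on UNIV c2"
    and per: "\<And>t. c (t + 1) = c t"
    and simple: "simple_path c"
    and curved: "\<And>t. Im (cnj (c1 t) * c2 t) > 0"
begin

lemma regular: "c1 t \<noteq> 0"
  using curved[of t] by auto

lemma per1: "c1 (t + 1) = c1 t"
  using has_vector_derivative_shift[of c c1 1 t, OF c] c[of t] vector_derivative_unique_at
  by (simp add: per)

lemma per2: "c2 (t + 1) = c2 t"
  using has_vector_derivative_shift[of c1 c2 1 t, OF c1] c1[of t] vector_derivative_unique_at
  by (simp add: per1)

lemma cont_c: "continuous_on A c" and cont_c1: "continuous_on A c1"
  using c c1 by (auto intro!: continuous_at_imp_continuous_on
      has_vector_derivative_continuous simp: continuous_within)

lemma path_image_c: "path_image c = range c"
proof -
  have "c t \<in> c ` {0..1}" for t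
  proof -
    obtain k :: int where "0 \<le> t + of_int k * 1" "t + of_int k * 1 < 0 + 1"
      using periodic_reduce[of 1 0 t] by auto
    then have "t + of_int k * 1 \<in> {0..1}" by simp
    then show ?thesis using periodic_int_multiple[of c 1 t k, OF per] by (metis image_eqI)
  qed
  then show ?thesis by (auto simp: path_image_def)
qed

text \<open>
The definition of a simple path speaks about parameters in \<open>{0..1}\<close>.  For the secant map below
injectivity is needed on a period with an arbitrary starting point.
\<close>

lemma injective_in_period:
  assumes "0 < d" "d < 1"
  shows "c (s + d) \<noteq> c s"
proof
  assume eq: "c (s + d) = c s"
  obtain k :: int where k: "0 \<le> s + of_int k * 1" "s + of_int k * 1 < 0 + 1"
    using periodic_reduce[of 1 0 s] by auto
  define s' where "s' = s + of_int k"
  define e where "e = (if s' + d \<le> 1 then d else d - 1)"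
  have cs: "c s' = c s" using periodic_int_multiple[of c 1 s k, OF per] by (simp add: s'_def)
  have "c (s' + d) = c (s + d)"
    using periodic_int_multiple[of c 1 "s + d" k, OF per] by (simp add: s'_def algebra_simps)
  moreover have "c (s' + e) = c (s' + d)" using per[of "s' + d - 1"] by (auto simp: e_def algebra_simps)
  ultimately have eq': "c (s' + e) = c s'" using eq cs by simp
  have r: "s' \<in> {0..1}" "s' + e \<in> {0..1}" "s' < 1" using k assms by (auto simp: s'_def e_def)
  have "s' + e = s' \<or> s' + e = 0 \<and> s' = 1 \<or> s' + e = 1 \<and> s' = 0"
    using simple r eq' unfolding simple_path_def loop_free_def by blast
  then show False using r assms by (auto simp: e_def split: if_splits)
qed

text \<open>
A logarithm of the velocity along the whole line: its imaginary part is a continuous tangent angle,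
and its derivative \<open>c2 / c1\<close> has the speed times the curvature as imaginary part.
\<close>

lemma velocity_logarithm:
  obtains A where "\<And>t. (A has_vector_derivative c2 t / c1 t) (at t)" "\<And>t. c1 t = exp (A t)"
proof -
  have "continuous_on UNIV (\<lambda>t. c2 t / c1 t)"
    by (intro continuous_intros c2 cont_c1) (auto simp: regular)
  then obtain B where B: "\<And>t. (B has_vector_derivative c2 t / c1 t) (at t)"
    using antiderivative_on_line by blast
  define k where "k = (\<lambda>t. c1 t * exp (- B t))"
  have "(k has_vector_derivative 0) (at t)" for t
  proof -
    have "(exp has_field_derivative exp (- B t)) (at (- B t))"
      by (rule DERIV_exp)
    then have "(exp \<circ> (\<lambda>t. - B t) has_vector_derivative - (c2 t / c1 t) * exp (- B t)) (at t)"
      by (intro field_vector_diff_chain_at has_vector_derivative_minus B)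
    from has_vector_derivative_mult[OF c1[of t] this]
    show ?thesis by (simp add: k_def regular)
  qed
  then have k: "k t = k 0" for t by (rule constant_if_derivative_zero)
  have k0: "k 0 \<noteq> 0" by (simp add: k_def regular)
  show thesis
  proof (rule that)
    show "((\<lambda>t. B t + Ln (k 0)) has_vector_derivative c2 t / c1 t) (at t)" for t
      using has_vector_derivative_add[OF B has_vector_derivative_const] by simp
    show "c1 t = exp (B t + Ln (k 0))" for t
      using k[of t] k0 by (simp add: exp_add k_def[THEN fun_cong, of t] exp_minus field_simps)
  qed
qed

text \<open>
The chord from \<open>c s\<close> to \<open>c (s + d)\<close> divided by \<open>d\<close>, written as a mean value of the velocity.  In
this form it extends continuously to \<open>d = 0\<close>.
\<close>

definition secant :: "real \<times> real \<Rightarrow> complex" where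
  "secant = (\<lambda>(s, d). integral {0..1} (\<lambda>x. c1 (s + x * d)))"

lemma continuous_secant: "continuous_on A secant"
proof -
  have "continuous_on (UNIV \<times> cbox 0 1) (\<lambda>(z, x). c1 (fst z + x * snd z))"
    unfolding case_prod_beta
    by (rule continuous_on_compose2[OF cont_c1[of UNIV]]) (auto intro!: continuous_intros)
  then have "continuous_on UNIV (\<lambda>z. integral (cbox 0 1) (\<lambda>x. c1 (fst z + x * snd z)))"
    by (rule integral_continuous_on_param)
  moreover have "secant = (\<lambda>z. integral (cbox 0 1) (\<lambda>x. c1 (fst z + x * snd z)))"
    by (auto simp: secant_def case_prod_beta cbox_interval)
  ultimately show ?thesis by (auto intro: continuous_on_subset)
qed

lemma secant_zero: "secant (s, 0) = c1 s"
  by (simp add: secant_def)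

lemma secant_chord: "d *\<^sub>R secant (s, d) = c (s + d) - c s"
proof -
  have "((\<lambda>x. d *\<^sub>R c1 (s + x * d)) has_integral (c (s + 1 * d) - c (s + 0 * d))) {0..1}"
  proof (rule fundamental_theorem_of_calculus)
    show "((\<lambda>x. c (s + x * d)) has_vector_derivative d *\<^sub>R c1 (s + x * d)) (at x within {0..1})" for x
    proof -
      have "(c \<circ> (\<lambda>x. s + x * d) has_vector_derivative d *\<^sub>R c1 (s + x * d)) (at x)"
        by (rule vector_diff_chain_at)
           (auto intro!: derivative_eq_intros c
             simp: has_real_derivative_iff_has_vector_derivative[symmetric])
      then show ?thesis by (auto simp: o_def intro: has_vector_derivative_at_within)
    qed
  qed simp
  then have "integral {0..1} (\<lambda>x. d *\<^sub>R c1 (s + x * d)) = c (s + d) - c s"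
    by (intro integral_unique) simp
  then show ?thesis by (simp add: secant_def)
qed

text \<open>
This is Hopf's secant map, \<open>(c (s + d) - c s) / (d * (1 - d))\<close> for \<open>0 < d < 1\<close>.  The chord vanishes
at \<open>d = 0\<close> and, since the curve is closed, also at \<open>d = 1\<close>.  Dividing by both factors makes the
map continuous and zero-free on the whole strip, with values \<open>c1 s\<close> and \<open>- c1 s\<close> on the two
edges.  Each branch uses the secant based at the end of the strip that is nearer to it.
\<close>

definition hopf_map :: "real \<times> real \<Rightarrow> complex" where
  "hopf_map = (\<lambda>(s, d). if d \<le> 1/2 then secant (s, d) / of_real (1 - d)
                        else - secant (s + 1, d - 1) / of_real d)"

lemma hopf_map_chord:
  assumes "0 < d" "d < 1"
  shows "hopf_map (s, d) = (1 / (d * (1 - d))) *\<^sub>R (c (s + d) - c s)"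
proof -
  have 1: "secant (s, d) = (c (s + d) - c s) / of_real d"
    using secant_chord[of d s] assms by (simp add: scaleR_conv_of_real field_simps)
  have "(d - 1) *\<^sub>R secant (s + 1, d - 1) = c (s + d) - c s"
    using secant_chord[of "d - 1" "s + 1"] per[of s] by simp
  then have "- secant (s + 1, d - 1) * of_real (1 - d) = c (s + d) - c s"
    by (simp add: scaleR_conv_of_real algebra_simps)
  moreover have "of_real (1 - d) \<noteq> (0 :: complex)" using assms by simp
  ultimately have 2: "- secant (s + 1, d - 1) = (c (s + d) - c s) / of_real (1 - d)"
    by (simp add: eq_divide_eq del: of_real_diff)
  show ?thesis
    by (simp add: hopf_map_def 1 2 scaleR_conv_of_real del: of_real_diff)
qed

lemma hopf_map_ends: "hopf_map (s, 0) = c1 s" "hopf_map (s, 1) = - c1 s"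
  by (simp_all add: hopf_map_def secant_zero per1)

lemma hopf_map_nonzero:
  assumes "d \<in> {0..1}" shows "hopf_map (s, d) \<noteq> 0"
proof (cases "d = 0 \<or> d = 1")
  case True
  then show ?thesis using hopf_map_ends regular by auto
next
  case False
  then show ?thesis using assms injective_in_period[of d s] by (simp add: hopf_map_chord)
qed

lemma continuous_hopf_map: "continuous_on (UNIV \<times> {0..1}) hopf_map"
proof -
  have "continuous_on (UNIV \<times> {0..1})
    (\<lambda>z. if snd z \<le> 1/2 then secant z / of_real (1 - snd z)
          else - secant (fst z + 1, snd z - 1) / of_real (snd z))"
  proof (rule continuous_on_cases_le)
    show "continuous_on {z \<in> UNIV \<times> {0..1}. snd z \<le> 1/2} (\<lambda>z. secant z / of_real (1 - snd z))"
      by (intro continuous_intros continuous_secant) auto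
    show "continuous_on {z \<in> UNIV \<times> {0..1}. 1/2 \<le> snd z}
        (\<lambda>z. - secant (fst z + 1, snd z - 1) / of_real (snd z))"
      by (intro continuous_intros continuous_on_compose2[OF continuous_secant[of UNIV]]) auto
    show "continuous_on (UNIV \<times> {0..1}) (snd :: real \<times> real \<Rightarrow> real)" by (intro continuous_intros)
  next
    fix z :: "real \<times> real"
    assume "snd z = 1/2"
    then obtain s where z: "z = (s, 1/2)" by (metis prod.collapse)
    have half: "(1/2) *\<^sub>R secant (s, 1/2) = c (s + 1/2) - c s" by (rule secant_chord)
    have "(1/2 - 1) *\<^sub>R secant (s + 1, 1/2 - 1) = c (s + 1 + (1/2 - 1)) - c (s + 1)"
      by (rule secant_chord)
    moreover have "s + 1 + (1/2 - 1) = s + 1/2" by simp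
    ultimately have "(-1/2) *\<^sub>R secant (s + 1, 1/2 - 1) = c (s + 1/2) - c s"
      using per[of s] by (simp add: add.commute[of "1/2" s])
    with half have "(1/2) *\<^sub>R secant (s, 1/2) = (-1/2) *\<^sub>R secant (s + 1, 1/2 - 1)" by simp
    from arg_cong[OF this, of "\<lambda>v. 2 *\<^sub>R v"]
    have "secant (s, 1/2) = - secant (s + 1, 1/2 - 1)" by simp
    then show "secant z / of_real (1 - snd z)
        = - secant (fst z + 1, snd z - 1) / of_real (snd z)"
      unfolding z by simp
  qed
  then show ?thesis unfolding hopf_map_def case_prod_beta prod.collapse .
qed

text \<open>
At a lowest point the tangent is horizontal.  Positive curvature means that a curve running to the
left there would bend downwards, which is impossible; so it runs to the right.
\<close>

lemma lowest_point:
  obtains t0 where "\<And>t. Im (c t0) \<le> Im (c t)" "Im (c1 t0) = 0" "Re (c1 t0) > 0"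
proof -
  have "\<exists>t\<in>{0..1}. \<forall>s\<in>{0..1}. Im (c t) \<le> Im (c s)"
    by (rule continuous_attains_inf) (auto intro!: continuous_intros cont_c)
  then obtain t0 where t0: "\<And>s. s \<in> {0..1} \<Longrightarrow> Im (c t0) \<le> Im (c s)" by blast
  have min: "Im (c t0) \<le> Im (c t)" for t
  proof -
    have "c t \<in> c ` {0..1}" using path_image_c by (auto simp: path_image_def)
    then show ?thesis using t0 by auto
  qed
  have d: "((\<lambda>t. Im (c t)) has_real_derivative Im (c1 t)) (at t)"
    "((\<lambda>t. Im (c1 t)) has_real_derivative Im (c2 t)) (at t)" for t
    by (rule vector_derivative_Re_Im c c1)+
  have z: "Im (c1 t0) = 0"
    by (rule DERIV_local_min[OF d(1), of 1]) (use min in auto)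
  have "Im (c2 t0) \<ge> 0"
  proof (rule ccontr)
    assume "\<not> Im (c2 t0) \<ge> 0"
    then obtain e where e: "e > 0" "\<And>h. h > 0 \<Longrightarrow> h < e \<Longrightarrow> Im (c1 (t0 + h)) < Im (c1 t0)"
      using DERIV_neg_dec_right[OF d(2)[of t0]] by auto
    obtain y where y: "t0 < y" "y < t0 + e/2" "Im (c (t0 + e/2)) - Im (c t0) = (t0 + e/2 - t0) * Im (c1 y)"
      using MVT2[of t0 "t0 + e/2" "\<lambda>t. Im (c t)" "\<lambda>t. Im (c1 t)"] d(1) e(1) by auto
    have "Im (c1 y) < 0" using e(2)[of "y - t0"] y z e(1) by simp
    then have "(t0 + e/2 - t0) * Im (c1 y) < 0" using e(1) by (simp add: mult_pos_neg)
    then show False using min[of "t0 + e/2"] y(3) by linarith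
  qed
  moreover have "Re (c1 t0) * Im (c2 t0) > 0" using curved[of t0] z by simp
  ultimately have "Re (c1 t0) > 0" by (auto simp: zero_less_mult_iff)
  with min z that show thesis by blast
qed

lemma cos_Im_exp:
  assumes "exp z = of_real r"
  shows "r > 0 \<Longrightarrow> cos (Im z) = 1" "r < 0 \<Longrightarrow> cos (Im z) = -1"
proof -
  have im: "sin (Im z) = 0" using arg_cong[OF assms, of Im] by (simp add: Im_exp)
  have re: "exp (Re z) * cos (Im z) = r" using arg_cong[OF assms, of Re] by (simp add: Re_exp)
  have "cos (Im z) = 1 \<or> cos (Im z) = -1" using im sin_zero_abs_cos_one by fastforce
  with re show "r > 0 \<Longrightarrow> cos (Im z) = 1" "r < 0 \<Longrightarrow> cos (Im z) = -1"
    by auto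
qed

text \<open>
Hopf's Umlaufsatz.  The strip is contractible, so the secant map has a continuous logarithm \<open>G\<close>.  Along
the edge \<open>d = 0\<close> it differs from the logarithm of the velocity by a constant, so it suffices to
follow \<open>G\<close> from \<open>(t0, 0)\<close> to \<open>(t0 + 1, 0)\<close> on any other route.  With \<open>t0\<close> a lowest point, take the
route through \<open>(t0, 1)\<close>: first all chords start at the lowest point and lie in the upper half
plane, afterwards all chords end there and lie in the lower half plane.  Each leg contributes
\<open>pi\<close>.
\<close>

lemma rotation_index_one:
  assumes A: "\<And>t. (A has_vector_derivative c2 t / c1 t) (at t)" "\<And>t. c1 t = exp (A t)"
  shows "Im (A (t + 1)) = Im (A t) + 2 * pi"
proof -
  obtain t0 where t0: "\<And>t. Im (c t0) \<le> Im (c t)" "Im (c1 t0) = 0" "Re (c1 t0) > 0"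
    using lowest_point by blast
  define r where "r = Re (c1 t0)"
  have r: "c1 t0 = of_real r" "r > 0" using t0 by (auto simp: r_def complex_eq_iff)
  obtain G where G: "continuous_on (UNIV \<times> {0..1}) G"
    "\<And>z. z \<in> UNIV \<times> {0..1} \<Longrightarrow> hopf_map z = exp (G z)"
    using continuous_logarithm_on_contractible[OF continuous_hopf_map]
      hopf_map_nonzero convex_imp_contractible[of "UNIV \<times> {0..1::real} :: (real \<times> real) set"]
    by (metis SigmaE convex_Times convex_UNIV convex_real_interval(5))
  have comp: "continuous_on {0..1} (\<lambda>x. Im (G (f x, g x)))"
    if "continuous_on {0..1} f" "continuous_on {0..1} g" "\<And>x. x \<in> {0..1} \<Longrightarrow> g x \<in> {0..1}"
    for f g :: "real \<Rightarrow> real"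
    by (intro continuous_intros continuous_on_compose2[OF G(1)] that) (use that in auto)
  have eG: "exp (G (s, d)) = hopf_map (s, d)" if "d \<in> {0..1}" for s d using G(2) that by simp
  have sin_nonneg: "sin (Im z) \<ge> 0" if "Im (exp z) \<ge> 0" for z
    using that by (simp add: Im_exp zero_le_mult_iff)
  \<comment> \<open>first leg: chords that start at the lowest point\<close>
  have "Im (G (t0, 1)) = Im (G (t0, 0)) + pi"
  proof (rule phase_gain_upper_half_plane)
    show "continuous_on {0..1} (\<lambda>x. Im (G (t0, x)))"
      by (rule comp) (auto intro: continuous_intros)
    show "cos (Im (G (t0, 0))) = 1" "cos (Im (G (t0, 1))) = -1"
      using r cos_Im_exp(1)[of "G (t0, 0)" r] cos_Im_exp(2)[of "G (t0, 1)" "- r"]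
      by (simp_all add: eG hopf_map_ends)
    show "sin (Im (G (t0, x))) \<ge> 0" if x: "x \<in> {0..1}" for x
    proof (rule sin_nonneg)
      show "0 \<le> Im (exp (G (t0, x)))"
        unfolding eG[OF x]
      proof (cases "x = 0 \<or> x = 1")
        case False
        then show "0 \<le> Im (hopf_map (t0, x))" using x t0(1)[of "t0 + x"]
          by (simp add: hopf_map_chord)
      qed (use t0 hopf_map_ends in auto)
    qed
  qed
  \<comment> \<open>second leg: chords that end at the lowest point; shifting by \<open>pi\<close> reflects them upwards\<close>
  moreover have "Im (G (t0 + 1, 1 - 1)) - pi = Im (G (t0 + 0, 1 - 0)) - pi + pi"
  proof (rule phase_gain_upper_half_plane[where h = "\<lambda>x. Im (G (t0 + x, 1 - x)) - pi"])
    show "continuous_on {0..1} (\<lambda>x. Im (G (t0 + x, 1 - x)) - pi)"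
      by (intro continuous_intros comp) auto
    show "cos (Im (G (t0 + 0, 1 - 0)) - pi) = 1" "cos (Im (G (t0 + 1, 1 - 1)) - pi) = -1"
      using r cos_Im_exp(1)[of "G (t0 + 1, 0)" r] cos_Im_exp(2)[of "G (t0, 1)" "- r"]
      by (simp_all add: eG hopf_map_ends per1)
    show "sin (Im (G (t0 + x, 1 - x)) - pi) \<ge> 0" if x: "x \<in> {0..1}" for x
    proof -
      have x': "1 - x \<in> {0..1}" using x by auto
      have "Im (hopf_map (t0 + x, 1 - x)) \<le> 0"
      proof (cases "x = 0 \<or> x = 1")
        case False
        have "c (t0 + 1) = c t0" by (rule per)
        then show ?thesis using x t0(1)[of "t0 + x"] False
          by (simp add: hopf_map_chord mult_nonneg_nonpos divide_nonpos_nonneg)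
      qed (use t0 hopf_map_ends per1 in auto)
      then have "Im (exp (G (t0 + x, 1 - x))) \<le> 0" by (simp add: eG[OF x'])
      then have "sin (Im (G (t0 + x, 1 - x))) \<le> 0"
        by (simp add: Im_exp mult_le_0_iff)
      then show ?thesis by (simp add: sin_diff)
    qed
  qed
  ultimately have G2: "Im (G (t0 + 1, 0)) = Im (G (t0, 0)) + 2 * pi" by simp
  \<comment> \<open>two logarithms of the velocity differ by a continuous integer, i.e. by a constant\<close>
  define k where "k = (\<lambda>s. (Im (G (s, 0)) - Im (A s)) / (2 * pi))"
  have k_int: "k s \<in> \<int>" for s
  proof -
    have "exp (G (s, 0)) = exp (A s)" using eG[of 0 s] A(2) by (simp add: hopf_map_ends)
    then obtain n :: int where "G (s, 0) = A s + of_real (of_int (2 * n) * pi) * \<i>"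
      using exp_eq by blast
    then have "Im (G (s, 0)) - Im (A s) = of_int n * (2 * pi)" by simp
    then show ?thesis by (simp add: k_def)
  qed
  have contA: "continuous_on S A" for S
    using A(1) by (auto intro!: continuous_at_imp_continuous_on has_vector_derivative_continuous)
  have "k constant_on UNIV"
  proof (rule continuous_discrete_range_constant)
    show "continuous_on UNIV k" unfolding k_def
      by (intro continuous_intros continuous_on_compose2[OF G(1)] contA) auto
    show "\<exists>e>0. \<forall>y. y \<in> UNIV \<and> k y \<noteq> k x \<longrightarrow> e \<le> norm (k y - k x)" for x
    proof (intro exI conjI allI impI)
      fix y assume "y \<in> UNIV \<and> k y \<noteq> k x"
      then show "1 \<le> norm (k y - k x)"
        using k_int[of x] k_int[of y] Ints_nonzero_abs_ge1[of "k y - k x"] by auto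
    qed simp
  qed auto
  then have "k (t0 + 1) = k t0" by (auto simp: constant_on_def)
  then have base: "Im (A (t0 + 1)) - Im (A t0) = 2 * pi" using G2 by (simp add: k_def)
  have "((\<lambda>t. A (t + 1) - A t) has_vector_derivative 0) (at x)" for x
    using has_vector_derivative_diff[OF has_vector_derivative_shift[of A "\<lambda>t. c2 t / c1 t" 1 x, OF A(1)] A(1)[of x]]
    by (simp add: per1 per2)
  then have "A (t + 1) - A t = A (t0 + 1) - A t0" by (rule constant_if_derivative_zero)
  then have "Im (A (t + 1) - A t) = Im (A (t0 + 1) - A t0)" by simp
  then show ?thesis using base by simp
qed

end


section \<open>Parametrization by the normal angle\<close>

context convex_loop
begin

text \<open>
The angle is normalized to be that of the outer normal, a quarter turn behind the tangent.
\<close>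

lemma turning_angle:
  obtains \<theta> \<theta>' :: "real \<Rightarrow> real"
  where "\<And>t. (\<theta> has_real_derivative \<theta>' t) (at t)" "\<And>t. \<theta>' t > 0" "continuous_on UNIV \<theta>'"
    "\<And>t. c1 t = norm (c1 t) *\<^sub>R (\<i> * cis (\<theta> t))" "\<And>t. \<theta> (t + 1) = \<theta> t + 2 * pi"
proof -
  obtain A where A: "\<And>t. (A has_vector_derivative c2 t / c1 t) (at t)" "\<And>t. c1 t = exp (A t)"
    using velocity_logarithm by blast
  show thesis
  proof (rule that)
    show "((\<lambda>t. Im (A t) - pi / 2) has_real_derivative Im (c2 t / c1 t)) (at t)" for t
      using DERIV_diff[OF vector_derivative_Re_Im(2)[OF A(1)] DERIV_const] by simp
    show "Im (c2 t / c1 t) > 0" for t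
    proof -
      have "c2 t / c1 t = (c2 t * cnj (c1 t)) / of_real ((norm (c1 t))\<^sup>2)"
        by (subst complex_div_cnj) simp
      then have "Im (c2 t / c1 t) = Im (cnj (c1 t) * c2 t) / (norm (c1 t))\<^sup>2"
        by (simp only: Im_divide_of_real mult.commute)
      then show ?thesis using curved[of t] regular[of t] by simp
    qed
    show "continuous_on UNIV (\<lambda>t. Im (c2 t / c1 t))"
      by (intro continuous_intros c2 cont_c1) (auto simp: regular)
    show "c1 t = norm (c1 t) *\<^sub>R (\<i> * cis (Im (A t) - pi / 2))" for t
    proof -
      have "\<i> * cis (Im (A t) - pi / 2) = cis (Im (A t))"
        by (simp add: complex_eq_iff cos_diff sin_diff)
      then show ?thesis
        using A(2)[of t] by (simp add: exp_eq_polar scaleR_conv_of_real norm_mult)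
    qed
    show "Im (A (t + 1)) - pi / 2 = Im (A t) - pi / 2 + 2 * pi" for t
      using rotation_index_one[OF A] by simp
  qed
qed

text \<open>
The normal angle increases strictly and gains \<open>2 * pi\<close> per period, so it is a bijection of the
line; \<open>\<tau>\<close> is its inverse.  That the period is \<open>2 * pi\<close> and not a multiple of it is what
the Umlaufsatz provides; all convexity of the curve follows from it.
\<close>

lemma normal_parametrization:
  obtains \<tau> \<tau>' :: "real \<Rightarrow> real"
  where "\<And>x. (\<tau> has_real_derivative \<tau>' x) (at x)" "\<And>x. \<tau>' x > 0" "continuous_on UNIV \<tau>'"
    "\<And>x. c1 (\<tau> x) = norm (c1 (\<tau> x)) *\<^sub>R (\<i> * cis x)" "\<And>x. \<tau> (x + 2 * pi) = \<tau> x + 1"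
    "surj \<tau>"
proof -
  obtain \<theta> \<theta>' :: "real \<Rightarrow> real" where
    d: "\<And>t. (\<theta> has_real_derivative \<theta>' t) (at t)" and pos: "\<And>t. \<theta>' t > 0"
    and cont': "continuous_on UNIV \<theta>'"
    and dir: "\<And>t. c1 t = norm (c1 t) *\<^sub>R (\<i> * cis (\<theta> t))"
    and turn: "\<And>t. \<theta> (t + 1) = \<theta> t + 2 * pi"
    using turning_angle by metis
  have mono: "strict_mono \<theta>"
  proof (rule strict_monoI)
    fix x y :: real assume "x < y"
    then show "\<theta> x < \<theta> y" using DERIV_pos_imp_increasing[of x y \<theta>] d pos by blast
  qed
  have inj: "inj \<theta>" using mono by (rule strict_mono_imp_inj_on)
  have isC: "isCont \<theta> t" for t using d by (rule DERIV_isCont)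
  have int: "\<theta> (t + of_int k * 1) - of_int k * (2 * pi) = \<theta> t" for t and k :: int
  proof -
    have "(\<lambda>t. \<theta> t - t * (2 * pi)) (t + of_int k * 1) = (\<lambda>t. \<theta> t - t * (2 * pi)) t"
      by (rule periodic_int_multiple) (simp add: turn algebra_simps)
    then show ?thesis by (simp add: algebra_simps)
  qed
  have surj: "surj \<theta>"
  proof (rule surjI)
    fix y
    obtain k :: int where k: "\<theta> 0 \<le> y + of_int k * (2 * pi)" "y + of_int k * (2 * pi) < \<theta> 0 + 2 * pi"
      using periodic_reduce[of "2 * pi" "\<theta> 0" y] by auto
    then have "y + of_int k * (2 * pi) \<le> \<theta> 1" using turn[of 0] by simp
    then obtain t where "\<theta> t = y + of_int k * (2 * pi)"
      using IVT'[of \<theta> 0 "y + of_int k * (2 * pi)" 1] k isC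
      by (auto intro: continuous_at_imp_continuous_on)
    then have "\<theta> (t + of_int (- k) * 1) = y" using int[of t "- k"] by simp
    then show "\<theta> (inv \<theta> y) = y" by (metis f_inv_into_f rangeI)
  qed
  define \<tau> where "\<tau> = inv \<theta>"
  have \<theta>\<tau>: "\<theta> (\<tau> x) = x" for x unfolding \<tau>_def by (rule surj_f_inv_f[OF surj])
  have \<tau>\<theta>: "\<tau> (\<theta> t) = t" for t unfolding \<tau>_def by (rule inv_f_f[OF inj])
  have cont\<tau>: "isCont \<tau> x" for x
    using isCont_inverse_function[where d = 1 and x = "\<tau> x" and f = \<theta> and g = \<tau>] \<tau>\<theta> isC \<theta>\<tau> by simp
  show thesis
  proof (rule that)
    show "(\<tau> has_real_derivative inverse (\<theta>' (\<tau> x))) (at x)" for x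
      by (rule DERIV_inverse_function[where f = \<theta> and g = \<tau> and a = "x - 1" and b = "x + 1"])
         (use d pos \<theta>\<tau> cont\<tau> in \<open>auto simp: less_imp_neq[OF pos, symmetric]\<close>)
    show "inverse (\<theta>' (\<tau> x)) > 0" for x using pos by simp
    show "continuous_on UNIV (\<lambda>x. inverse (\<theta>' (\<tau> x)))"
      by (intro continuous_intros continuous_on_compose2[OF cont'] continuous_at_imp_continuous_on)
         (use pos cont\<tau> in \<open>auto simp: less_imp_neq[OF pos, symmetric]\<close>)
    show "c1 (\<tau> x) = norm (c1 (\<tau> x)) *\<^sub>R (\<i> * cis x)" for x using dir[of "\<tau> x"] by (simp add: \<theta>\<tau>)
    show "\<tau> (x + 2 * pi) = \<tau> x + 1" for x
      using turn[of "\<tau> x"] \<tau>\<theta>[of "\<tau> x + 1"] by (simp add: \<theta>\<tau>)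
    show "surj \<tau>" using \<tau>\<theta> by (metis surjI)
  qed
qed

end

locale normal_parametrized_loop = convex_loop +
  fixes \<tau> \<tau>' :: "real \<Rightarrow> real"
  assumes \<tau>: "\<And>x. (\<tau> has_real_derivative \<tau>' x) (at x)"
    and \<tau>'_pos: "\<And>x. \<tau>' x > 0"
    and \<tau>'_cont: "continuous_on UNIV \<tau>'"
    and normal: "\<And>x. c1 (\<tau> x) = norm (c1 (\<tau> x)) *\<^sub>R (\<i> * cis x)"
    and \<tau>_turn: "\<And>x. \<tau> (x + 2 * pi) = \<tau> x + 1"
    and \<tau>_surj: "surj \<tau>"

context convex_loop
begin

lemma ex_normal_parametrized_loop:
  obtains \<tau> \<tau>' where "normal_parametrized_loop c c1 c2 \<tau> \<tau>'"
proof (rule normal_parametrization)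
  fix \<tau> \<tau>' :: "real \<Rightarrow> real"
  assume *: "\<And>x. (\<tau> has_real_derivative \<tau>' x) (at x)" "\<And>x. 0 < \<tau>' x" "continuous_on UNIV \<tau>'"
    "\<And>x. c1 (\<tau> x) = norm (c1 (\<tau> x)) *\<^sub>R (\<i> * cis x)"
    "\<And>x. \<tau> (x + 2 * pi) = \<tau> x + 1" "surj \<tau>"
  have "normal_parametrized_loop c c1 c2 \<tau> \<tau>'"
    by unfold_locales (fact *)+
  then show thesis by (rule that)
qed

end

context normal_parametrized_loop
begin

text \<open>
The speed of the curve when it is parametrized by its normal angle, i.e. its radius of curvature.
\<close>

definition \<rho> :: "real \<Rightarrow> real" where
  "\<rho> x = norm (c1 (\<tau> x)) * \<tau>' x"

lemma \<rho>_pos: "\<rho> x > 0"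
  by (simp add: \<rho>_def regular \<tau>'_pos)

lemma cont_\<tau>: "continuous_on A \<tau>"
  by (auto intro!: continuous_at_imp_continuous_on DERIV_isCont[OF \<tau>])

lemma cont_\<rho>: "continuous_on A \<rho>"
  unfolding \<rho>_def
  by (intro continuous_intros continuous_on_compose2[OF cont_c1[of UNIV] cont_\<tau>]
      continuous_on_subset[OF \<tau>'_cont]) auto

lemma \<tau>'_per: "\<tau>' (x + 2 * pi) = \<tau>' x"
proof -
  have "((\<lambda>x. \<tau> (x + 2 * pi)) has_real_derivative \<tau>' (x + 2 * pi)) (at x)"
    by (rule DERIV_shift[THEN iffD1, OF \<tau>])
  moreover have "((\<lambda>x. \<tau> (x + 2 * pi)) has_real_derivative \<tau>' x) (at x)"
    unfolding \<tau>_turn by (auto intro!: derivative_eq_intros \<tau>)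
  ultimately show ?thesis by (rule DERIV_unique)
qed

lemma \<rho>_per: "\<rho> (x + 2 * pi) = \<rho> x"
  by (simp add: \<rho>_def \<tau>'_per \<tau>_turn per1)

lemma point_derivative:
  "((\<lambda>x. c (\<tau> x)) has_vector_derivative \<rho> x *\<^sub>R (\<i> * cis x)) (at x)"
proof -
  have "(c \<circ> \<tau> has_vector_derivative \<tau>' x *\<^sub>R c1 (\<tau> x)) (at x)"
    by (rule vector_diff_chain_at)
       (use \<tau> c in \<open>auto simp: has_real_derivative_iff_has_vector_derivative[symmetric]\<close>)
  moreover have "\<tau>' x *\<^sub>R c1 (\<tau> x) = \<rho> x *\<^sub>R (\<i> * cis x)"
    by (subst normal) (simp add: \<rho>_def mult.commute)
  ultimately show ?thesis by (simp add: o_def)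
qed

lemma integral_over_normals:
  assumes "continuous_on UNIV f" "\<And>t. f (t + 1) = (f t :: real)"
  shows "integral {0..2*pi} (\<lambda>x. f (\<tau> x) * \<tau>' x) = integral {0..1} f"
proof -
  obtain F where F: "\<And>x. (F has_vector_derivative f x) (at x)"
    using antiderivative_on_line[OF assms(1)] by blast
  have "((F \<circ> \<tau>) has_vector_derivative \<tau>' x *\<^sub>R f (\<tau> x)) (at x)" for x
    by (rule vector_diff_chain_at)
       (use \<tau> F in \<open>auto simp: has_real_derivative_iff_has_vector_derivative[symmetric]\<close>)
  then have "((\<lambda>x. F (\<tau> x)) has_vector_derivative f (\<tau> x) * \<tau>' x) (at x)" for x
    by (simp add: o_def mult.commute)
  from integral_eq_antiderivative_diff[OF this, of 0 "2 * pi"]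
  have "integral {0..2*pi} (\<lambda>x. f (\<tau> x) * \<tau>' x) = F (\<tau> 0 + 1) - F (\<tau> 0)"
    using \<tau>_turn[of 0] by simp
  also have "\<dots> = integral {\<tau> 0..\<tau> 0 + 1} f"
    using integral_eq_antiderivative_diff[OF F, of "\<tau> 0" "\<tau> 0 + 1"] by simp
  also have "\<dots> = integral {0..0+1} f"
    by (rule integral_periodic_shift) (use assms in auto)
  finally show ?thesis by simp
qed

lemma length_eq: "integral {0..1} (\<lambda>t. norm (c1 t)) = integral {0..2*pi} \<rho>"
  using integral_over_normals[of "\<lambda>t. norm (c1 t)"] cont_c1
  by (simp add: \<rho>_def[abs_def] per1 continuous_on_norm)

text \<open>
The height of the curve over the tangent at \<open>\<phi>\<close> has derivative \<open>\<rho> x * sin (\<phi> - x)\<close>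
with respect to the normal angle \<open>x\<close>.  It falls during the first half turn after \<open>\<phi>\<close>, rises
during the second one, and is back at its initial value after the full turn.
\<close>

lemma below_tangent: "inner (c t - c (\<tau> \<phi>)) (cis \<phi>) \<le> 0"
proof -
  define h where "h = (\<lambda>x. inner (c (\<tau> x)) (cis \<phi>))"
  have h: "(h has_real_derivative \<rho> x * sin (\<phi> - x)) (at x)" for x
  proof -
    have "(h has_vector_derivative inner (\<rho> x *\<^sub>R (\<i> * cis x)) (cis \<phi>)) (at x)"
      unfolding h_def
      by (rule bounded_linear.has_vector_derivative[OF bounded_linear_inner_left point_derivative])
    moreover have "inner (\<rho> x *\<^sub>R (\<i> * cis x)) (cis \<phi>) = \<rho> x * sin (\<phi> - x)"
      by (simp add: inner_complex_def sin_diff algebra_simps)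
    ultimately show ?thesis by (simp only: has_real_derivative_iff_has_vector_derivative)
  qed
  have per_h: "h (x + 2 * pi) = h x" for x by (simp add: h_def \<tau>_turn per)
  have max: "h x \<le> h \<phi>" if x: "\<phi> \<le> x" "x < \<phi> + 2 * pi" for x
  proof (cases "x \<le> \<phi> + pi")
    case True
    have "\<exists>y. (h has_real_derivative y) (at z) \<and> y \<le> 0" if "\<phi> \<le> z" "z \<le> x" for z
    proof -
      have "0 \<le> sin (z - \<phi>)" using that True by (intro sin_ge_zero) auto
      then have "sin (\<phi> - z) \<le> 0" using sin_minus[of "z - \<phi>"] by simp
      then show ?thesis using h[of z] \<rho>_pos[of z] by (intro exI[of _ "\<rho> z * sin (\<phi> - z)"]) (simp add: mult_le_0_iff)
    qed
    then show ?thesis by (intro DERIV_nonpos_imp_nonincreasing[OF x(1)]) blast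
  next
    case False
    have incr: "\<exists>y. (h has_real_derivative y) (at z) \<and> 0 \<le> y" if "x \<le> z" "z \<le> \<phi> + 2 * pi" for z
    proof -
      have "0 \<le> sin (\<phi> + 2 * pi - z)" using that False by (intro sin_ge_zero) auto
      also have "\<phi> + 2 * pi - z = (\<phi> - z) + 2 * pi" by simp
      finally have "0 \<le> sin (\<phi> - z)" by (simp only: sin_periodic)
      then show ?thesis using h[of z] \<rho>_pos[of z] by (intro exI[of _ "\<rho> z * sin (\<phi> - z)"]) (simp add: zero_le_mult_iff)
    qed
    have "h x \<le> h (\<phi> + 2 * pi)"
      by (rule DERIV_nonneg_imp_nondecreasing[OF less_imp_le[OF x(2)]]) (rule incr)
    then show ?thesis by (simp add: per_h)
  qed
  obtain y where y: "t = \<tau> y" using \<tau>_surj by (metis surjD)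
  obtain k :: int where "\<phi> \<le> y + of_int k * (2 * pi)" "y + of_int k * (2 * pi) < \<phi> + 2 * pi"
    using periodic_reduce[of "2 * pi" \<phi> y] by auto
  then have "h (y + of_int k * (2 * pi)) \<le> h \<phi>" by (rule max)
  moreover have "h (y + of_int k * (2 * pi)) = h y"
    by (rule periodic_int_multiple[of h "2 * pi" y k]) (rule per_h)
  ultimately have "h y \<le> h \<phi>" by simp
  then show ?thesis by (simp add: h_def y inner_diff_left)
qed

text \<open>
The complement of a convex set that contains the curve lies outside of the curve; since the inside
is open, its points even stay off the tangent line.
\<close>

lemma inside_below_tangent:
  assumes "q \<in> inside (path_image c)"
  shows "inner (q - c (\<tau> \<phi>)) (cis \<phi>) < 0"
proof -
  define H where "H = {x. inner (cis \<phi>) x \<le> inner (cis \<phi>) (c (\<tau> \<phi>))}"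
  have "convex H" unfolding H_def by (rule convex_halfspace_le)
  moreover have "path_image c \<subseteq> H"
    using below_tangent[of _ \<phi>]
    by (auto simp: path_image_c H_def inner_diff_left inner_commute[of "cis \<phi>"])
  ultimately have "- H \<subseteq> outside (path_image c)" by (rule outside_subset_convex)
  then have "inside (path_image c) \<subseteq> H" using inside_Int_outside by blast
  moreover have "open (inside (path_image c))"
    using simple by (simp add: open_inside closed_path_image simple_path_imp_path)
  ultimately have "inside (path_image c) \<subseteq> interior H" by (rule interior_maximal)
  also have "interior H = {x. inner (cis \<phi>) x < inner (cis \<phi>) (c (\<tau> \<phi>))}"
    unfolding H_def by (rule interior_halfspace_le) simp
  finally show ?thesis using assms by (auto simp: inner_diff_left inner_commute[of "cis \<phi>"])
qed

end


section \<open>Area of the enclosed region\<close>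

(* The dollar sign is used for vector components only. *)
no_notation fps_nth (infixl \<open>$\<close> 75)

text \<open>
The region lives in \<^typ>\<open>complex\<close>, the Jacobian determinant is that of a map of \<^typ>\<open>real^2\<close>, and
the iterated integral is one over pairs.  Passing between these copies of the plane only renames
coordinates; it preserves Lebesgue measure because boxes go to boxes with the same side lengths.
\<close>

lemma lborel_distr_basis_bij:
  fixes f :: "'a::euclidean_space \<Rightarrow> 'b::euclidean_space"
  assumes "linear f" "bij_betw f Basis Basis" "\<And>x b. b \<in> Basis \<Longrightarrow> f x \<bullet> f b = x \<bullet> b"
  shows "distr lborel borel f = lborel"
proof (rule lborel_eqI[symmetric])
  have [measurable]: "f \<in> borel \<rightarrow>\<^sub>M borel"
    using assms(1) by (intro borel_measurable_continuous_onI linear_continuous_on)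
      (simp add: linear_linear)
  have Basis_eq: "(Basis :: 'b set) = f ` Basis" using assms(2) by (simp add: bij_betw_def)
  fix l u :: 'b
  assume le: "\<And>b. b \<in> Basis \<Longrightarrow> l \<bullet> b \<le> u \<bullet> b"
  define pull where "pull = (\<lambda>z :: 'b. \<Sum>b\<in>Basis. (z \<bullet> f b) *\<^sub>R b)"
  have pull: "pull z \<bullet> b = z \<bullet> f b" if "b \<in> Basis" for z b
    unfolding pull_def using that by (rule inner_sum_left_Basis)
  have "f -` box l u = box (pull l) (pull u)"
    by (auto simp: box_def Basis_eq pull assms(3))
  then have "emeasure (distr lborel borel f) (box l u) = emeasure lborel (box (pull l) (pull u))"
    by (simp add: emeasure_distr)
  also have "\<dots> = (\<Prod>b\<in>Basis. (pull u - pull l) \<bullet> b)"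
    by (rule emeasure_lborel_box) (use le in \<open>auto simp: pull Basis_eq\<close>)
  also have "(\<Prod>b\<in>Basis. (pull u - pull l) \<bullet> b) = (\<Prod>b\<in>Basis. (u - l) \<bullet> f b)"
    by (intro prod.cong) (auto simp: inner_diff_left pull)
  also have "\<dots> = (\<Prod>b\<in>Basis. (u - l) \<bullet> b)"
    using prod.reindex_bij_betw[OF assms(2), of "\<lambda>b. (u - l) \<bullet> b"] by simp
  finally show "emeasure (distr lborel borel f) (box l u) = (\<Prod>b\<in>Basis. (u - l) \<bullet> b)" .
qed simp

definition complex_of_vec :: "real^2 \<Rightarrow> complex" where
  "complex_of_vec v = Complex (v $ 1) (v $ 2)"

definition vec_of_complex :: "complex \<Rightarrow> real^2" where
  "vec_of_complex z = vector [Re z, Im z]"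

definition vec_of_pair :: "real \<times> real \<Rightarrow> real^2" where
  "vec_of_pair p = vector [fst p, snd p]"

lemma complex_vec_inverse [simp]:
  "complex_of_vec (vec_of_complex z) = z" "vec_of_complex (complex_of_vec v) = v"
  by (auto simp: complex_of_vec_def vec_of_complex_def vec_eq_iff forall_2 complex_eq_iff)

lemma linear_vec_of_complex: "linear vec_of_complex"
  by (rule linearI) (auto simp: vec_of_complex_def vec_eq_iff forall_2)

lemma linear_complex_of_vec: "linear complex_of_vec"
  by (rule linearI) (auto simp: complex_of_vec_def complex_eq_iff)

lemma linear_vec_of_pair: "linear vec_of_pair"
  by (rule linearI) (auto simp: vec_of_pair_def vec_eq_iff forall_2)

lemma Basis_real_2: "(Basis :: (real^2) set) = {axis 1 1, axis 2 1}"
  by (auto simp: Basis_vec_def UNIV_2)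

lemma distr_vec_of_complex: "distr lborel borel vec_of_complex = lborel"
proof (rule lborel_distr_basis_bij[OF linear_vec_of_complex])
  have v: "vec_of_complex 1 = axis 1 1" "vec_of_complex \<i> = axis 2 1"
    by (auto simp: vec_of_complex_def vec_eq_iff forall_2 axis_def)
  show "bij_betw vec_of_complex Basis Basis"
    by (auto simp: bij_betw_def inj_on_def Basis_complex_def Basis_real_2 v axis_eq_axis)
  show "vec_of_complex x \<bullet> vec_of_complex b = x \<bullet> b" for x b
    by (simp add: vec_of_complex_def inner_vec_def sum_2 inner_complex_def)
qed

lemma distr_vec_of_pair: "distr lborel borel vec_of_pair = lborel"
proof (rule lborel_distr_basis_bij[OF linear_vec_of_pair])
  have v: "vec_of_pair (1, 0) = axis 1 1" "vec_of_pair (0, 1) = axis 2 1"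
    by (auto simp: vec_of_pair_def vec_eq_iff forall_2 axis_def)
  show "bij_betw vec_of_pair Basis Basis"
    by (auto simp: bij_betw_def inj_on_def Basis_prod_def Basis_real_2 v axis_eq_axis)
  show "vec_of_pair x \<bullet> vec_of_pair b = x \<bullet> b" for x b
    by (simp add: vec_of_pair_def inner_vec_def sum_2 inner_prod_def)
qed

text \<open>
The polar coordinates below have the Jacobian \<open>r * D t\<close>, and the radial factor integrates to
\<open>1/2\<close>.  The square is half open in \<open>t\<close> in order to meet each ray exactly once.
\<close>

lemma integral_wedge:
  fixes D :: "real \<Rightarrow> real"
  assumes D: "continuous_on UNIV D"
  defines "S \<equiv> {v :: real^2. v $ 1 \<in> {0<..<1} \<and> v $ 2 \<in> {0..<1}}"
  shows "S \<in> sets lebesgue" "(\<lambda>v. v $ 1 * D (v $ 2)) integrable_on S"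
    "integral S (\<lambda>v. v $ 1 * D (v $ 2)) = 1/2 * integral {0..1} D"
proof -
  let ?F = "\<lambda>v :: real^2. v $ 1 * D (v $ 2)"
  have contF: "continuous_on A ?F" for A
    by (intro continuous_intros continuous_on_compose2[OF D]) auto
  have [measurable]: "(\<lambda>v. v $ i) \<in> borel_measurable (borel :: (real^2) measure)" for i
    by (intro borel_measurable_continuous_onI continuous_intros)
  have [measurable]: "?F \<in> borel_measurable borel"
    by (rule borel_measurable_continuous_onI[OF contF])
  have [measurable]: "D \<in> borel_measurable borel"
    by (rule borel_measurable_continuous_onI[OF D])
  have [measurable]: "vec_of_pair \<in> borel \<rightarrow>\<^sub>M borel"
    using linear_vec_of_pair by (intro borel_measurable_continuous_onI linear_continuous_on)
      (simp add: linear_linear)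
  have Sb [measurable]: "S \<in> sets borel" unfolding S_def by measurable
  then show S: "S \<in> sets lebesgue" by simp
  have "S \<subseteq> cbox 0 1"
    by (auto simp: S_def mem_box_cart forall_2)
  then have abs: "?F absolutely_integrable_on S"
    by (rule set_integrable_subset[OF absolutely_integrable_continuous[OF contF] S])
  then show "?F integrable_on S" by (rule set_lebesgue_integral_eq_integral)
  let ?G = "\<lambda>v. indicator S v *\<^sub>R ?F v"
  let ?g = "\<lambda>x. indicator {0<..<1} x * x :: real"
  let ?h = "\<lambda>y. indicator {0..<1} y * D y :: real"
  have G: "?G (vec_of_pair (x, y)) = ?g x * ?h y" for x y
    by (auto simp: S_def vec_of_pair_def indicator_def)
  have Geq: "(\<lambda>p. ?G (vec_of_pair p)) = (\<lambda>(x, y). ?g x * ?h y)"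
  proof (rule ext)
    show "?G (vec_of_pair p) = (case p of (x, y) \<Rightarrow> ?g x * ?h y)" for p
      by (cases p) (simp only: G case_prod_conv)
  qed
  have iG: "integrable lborel ?G"
    using abs unfolding set_integrable_def
    by (subst (asm) integrable_completion) (auto simp: lborel_def intro!: borel_measurable_indicator)
  have "integral S ?F = (LINT v:S|lebesgue. ?F v)"
    using set_lebesgue_integral_eq_integral(2)[OF abs] by simp
  also have "\<dots> = integral\<^sup>L lborel ?G"
    unfolding set_lebesgue_integral_def by (rule integral_completion) measurable
  also have "\<dots> = integral\<^sup>L (distr lborel borel vec_of_pair) ?G"
    by (simp add: distr_vec_of_pair)
  also have "\<dots> = integral\<^sup>L (lborel \<Otimes>\<^sub>M lborel) (\<lambda>p. ?G (vec_of_pair p))"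
    unfolding lborel_prod by (rule integral_distr) auto
  also have "\<dots> = integral\<^sup>L (lborel \<Otimes>\<^sub>M lborel) (\<lambda>(x, y). ?g x * ?h y)"
    unfolding Geq ..
  also have "\<dots> = (\<integral>x. (\<integral>y. ?g x * ?h y \<partial>lborel) \<partial>lborel)"
  proof (rule lborel_pair.integral_fst[symmetric])
    have "integrable (distr lborel borel vec_of_pair) ?G" using iG by (simp add: distr_vec_of_pair)
    then have "integrable (lborel \<Otimes>\<^sub>M lborel) (\<lambda>p. ?G (vec_of_pair p))"
      unfolding lborel_prod by (subst (asm) integrable_distr_eq) auto
    then show "integrable (lborel \<Otimes>\<^sub>M lborel) (\<lambda>(x, y). ?g x * ?h y)"
      unfolding Geq .
  qed
  also have "\<dots> = integral\<^sup>L lborel ?g * integral\<^sup>L lborel ?h"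
    by simp
  also have "integral\<^sup>L lborel ?g = 1/2"
  proof -
    have "(LINT x:{0<..<1}|lborel. x :: real) = integral {0<..<1} (\<lambda>x. x)"
      by (rule set_borel_integral_eq_integral)
         (rule set_integrable_subset[OF borel_integrable_compact[of "{0..1::real}", folded set_integrable_def]], auto)
    also have "\<dots> = integral {0..1} (\<lambda>x :: real. x)"
      by (rule integral_spike_set) (auto intro: negligible_subset[of "{0, 1}"])
    also have "\<dots> = 1/2" using ident_has_integral[of 0 "1::real"] by (simp add: integral_unique)
    finally show ?thesis by (simp add: set_lebesgue_integral_def)
  qed
  also have "integral\<^sup>L lborel ?h = integral {0..1} D"
  proof -
    have "(LINT x:{0..<1}|lborel. D x) = integral {0..<1} D"
      by (rule set_borel_integral_eq_integral)
         (rule set_integrable_subset[OF borel_integrable_compact[of "{0..1::real}", folded set_integrable_def]],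
           auto intro: continuous_on_subset[OF D])
    also have "\<dots> = integral {0..1} D"
      by (rule integral_spike_set) (auto intro: negligible_subset[of "{1}"])
    finally show ?thesis by (simp add: set_lebesgue_integral_def)
  qed
  finally show "integral S ?F = 1/2 * integral {0..1} D" .
qed

context normal_parametrized_loop
begin

text \<open>
Between \<open>q\<close> and \<open>c t\<close> every point lies strictly below all tangents, because \<open>q\<close> does and \<open>c t\<close>
lies weakly below.  A point on the curve violates this for its own tangent, so the segment does
not meet the curve and stays inside.
\<close>

lemma scaled_point_inside:
  assumes q: "q \<in> inside (path_image c)" and r: "0 \<le> r" "r < 1"
  shows "q + r *\<^sub>R (c t - q) \<in> inside (path_image c)"
proof -
  have off: "q + s *\<^sub>R (c t - q) \<notin> path_image c" if s: "0 \<le> s" "s < 1" for s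
  proof
    assume "q + s *\<^sub>R (c t - q) \<in> path_image c"
    then obtain u where u: "q + s *\<^sub>R (c t - q) = c u" by (auto simp: path_image_c)
    obtain \<phi> where \<phi>: "u = \<tau> \<phi>" using \<tau>_surj by (metis surjD)
    have "0 = inner (q + s *\<^sub>R (c t - q) - c (\<tau> \<phi>)) (cis \<phi>)" using u \<phi> by simp
    also have "\<dots> = (1 - s) * inner (q - c (\<tau> \<phi>)) (cis \<phi>) + s * inner (c t - c (\<tau> \<phi>)) (cis \<phi>)"
      by (simp add: inner_diff_left inner_add_left algebra_simps)
    also have "\<dots> < 0"
      using inside_below_tangent[OF q, of \<phi>] below_tangent[of t \<phi>] s
      by (intro add_neg_nonpos mult_pos_neg mult_nonneg_nonpos) auto
    finally show False by simp
  qed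
  have "connected_component (- path_image c) q (q + r *\<^sub>R (c t - q))"
  proof (rule connected_componentI)
    show "connected (closed_segment q (q + r *\<^sub>R (c t - q)))" by simp
    show "closed_segment q (q + r *\<^sub>R (c t - q)) \<subseteq> - path_image c"
    proof
      fix x assume "x \<in> closed_segment q (q + r *\<^sub>R (c t - q))"
      then obtain u where u: "0 \<le> u" "u \<le> 1" "x = (1 - u) *\<^sub>R q + u *\<^sub>R (q + r *\<^sub>R (c t - q))"
        by (auto simp: closed_segment_def)
      then have "x = q + (u * r) *\<^sub>R (c t - q)" by (simp add: algebra_simps)
      moreover have "u * r < 1" using u r by (metis mult_left_le_one_le order_le_less_trans)
      ultimately show "x \<in> - path_image c" using off[of "u * r"] u r by simp
    qed
  qed auto
  then show ?thesis using q by (rule inside_same_component)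
qed

text \<open>
The ray from \<open>q\<close> through an inside point \<open>x\<close> leaves the inside at a curve point.  That point lies
beyond \<open>x\<close>, as otherwise it would be between two points that are strictly below its own tangent.
\<close>

lemma inside_star_parametrization:
  assumes q: "q \<in> inside (path_image c)"
  shows "(\<lambda>(r, t). q + r *\<^sub>R (c t - q)) ` ({0<..<1} \<times> {0..<1}) = inside (path_image c) - {q}"
proof (intro equalityI subsetI)
  fix x assume "x \<in> (\<lambda>(r, t). q + r *\<^sub>R (c t - q)) ` ({0<..<1} \<times> {0..<1})"
  then obtain r t where x: "x = q + r *\<^sub>R (c t - q)" "0 < r" "r < 1" by auto
  have "c t \<noteq> q" using q inside_no_overlap[of "path_image c"] path_image_c by blast
  then show "x \<in> inside (path_image c) - {q}" using scaled_point_inside[OF q, of r t] x by auto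
next
  fix x assume x: "x \<in> inside (path_image c) - {q}"
  have cl: "closed (path_image c)" and bd: "bounded (path_image c)"
    using simple by (auto simp: closed_path_image bounded_path_image simple_path_imp_path)
  have "q \<in> interior (inside (path_image c))" using q open_inside[OF cl] by (simp add: interior_open)
  then obtain d where d: "0 < d" "q + d *\<^sub>R (x - q) \<in> frontier (inside (path_image c))"
    using ray_to_frontier[OF bounded_inside[OF bd], of q "x - q"] x by auto
  then have "q + d *\<^sub>R (x - q) \<in> path_image c" using frontier_inside_subset[OF cl] by blast
  then obtain t where t: "q + d *\<^sub>R (x - q) = c t" "t \<in> {0..1}" by (auto simp: path_image_def)
  define s where "s = (if t = 1 then 0 else t)"
  have s: "s \<in> {0..<1}" "c s = c t" using t(2) per[of 0] by (auto simp: s_def)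
  have "d > 1"
  proof (rule ccontr)
    assume "\<not> d > 1"
    obtain \<phi> where \<phi>: "t = \<tau> \<phi>" using \<tau>_surj by (metis surjD)
    have "0 = inner (q + d *\<^sub>R (x - q) - c (\<tau> \<phi>)) (cis \<phi>)" using t(1) \<phi> by simp
    also have "\<dots> = (1 - d) * inner (q - c (\<tau> \<phi>)) (cis \<phi>) + d * inner (x - c (\<tau> \<phi>)) (cis \<phi>)"
      by (simp add: inner_diff_left inner_add_left algebra_simps)
    also have "\<dots> < 0"
      using inside_below_tangent[OF q, of \<phi>] inside_below_tangent[of x \<phi>] x d \<open>\<not> d > 1\<close>
      by (intro add_nonpos_neg mult_pos_neg mult_nonneg_nonpos) auto
    finally show False by simp
  qed
  have "q + (1/d) *\<^sub>R (c s - q) = q + (1/d) *\<^sub>R (d *\<^sub>R (x - q))"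
    unfolding s(2) t(1)[symmetric] by simp
  also have "\<dots> = x" using d by simp
  finally have "x = q + (1/d) *\<^sub>R (c s - q)" ..
  then show "x \<in> (\<lambda>(r, t). q + r *\<^sub>R (c t - q)) ` ({0<..<1} \<times> {0..<1})"
    using \<open>d > 1\<close> s(1) by (intro image_eqI[of _ _ "(1/d, s)"]) auto
qed

text \<open>
Two curve points on a common ray from \<open>q\<close> coincide, since the nearer one would be inside.
\<close>

lemma star_parametrization_inj:
  assumes q: "q \<in> inside (path_image c)"
  shows "inj_on (\<lambda>(r, t). q + r *\<^sub>R (c t - q)) ({0<..<1} \<times> {0..<1})"
proof -
  have not_less: "\<not> r < r'" if eq: "q + r *\<^sub>R (c t - q) = q + r' *\<^sub>R (c t' - q)" and r: "0 < r" for r r' t t'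
  proof
    assume less: "r < r'"
    have "c t' = q + (1/r') *\<^sub>R (r' *\<^sub>R (c t' - q))" using less r by simp
    also have "r' *\<^sub>R (c t' - q) = r *\<^sub>R (c t - q)" using eq by simp
    also have "q + (1/r') *\<^sub>R (r *\<^sub>R (c t - q)) = q + (r/r') *\<^sub>R (c t - q)" by simp
    also have "\<dots> \<in> inside (path_image c)" by (rule scaled_point_inside[OF q]) (use less r in auto)
    finally show False using inside_no_overlap[of "path_image c"] path_image_c by blast
  qed
  show ?thesis
  proof (rule inj_onI, clarsimp)
    fix r t r' t' :: real
    assume r: "0 < r" "0 < r'" and t: "0 \<le> t" "t < 1" "0 \<le> t'" "t' < 1"
      and eq: "r *\<^sub>R (c t - q) = r' *\<^sub>R (c t' - q)"
    have "r = r'" using not_less[of r t r' t'] not_less[of r' t' r t] eq r by auto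
    moreover from this have "c t = c t'" using eq r by simp
    then have "t = t'"
      using injective_in_period[of "t' - t" t] injective_in_period[of "t - t'" t'] t by fastforce
    ultimately show "r = r' \<and> t = t'" by simp
  qed
qed

lemma cross_product_at_normal:
  "Im (cnj (c (\<tau> \<phi>) - q) * c1 (\<tau> \<phi>)) = norm (c1 (\<tau> \<phi>)) * inner (c (\<tau> \<phi>) - q) (cis \<phi>)"
  by (subst normal) (simp add: inner_complex_def algebra_simps)

lemma cross_product_pos:
  assumes "q \<in> inside (path_image c)"
  shows "Im (cnj (c t - q) * c1 t) > 0"
proof -
  obtain \<phi> where \<phi>: "t = \<tau> \<phi>" using \<tau>_surj by (metis surjD)
  show ?thesis
    unfolding \<phi> cross_product_at_normal using inside_below_tangent[OF assms, of \<phi>] regular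
    by (simp add: inner_diff_left)
qed

text \<open>
Change of variables to polar coordinates around \<open>q\<close> that are adapted to the curve: the map
\<open>(r, t) \<mapsto> q + r (c t - q)\<close> is injective and covers the inside except for \<open>q\<close>.
\<close>

lemma area_eq:
  assumes q: "q \<in> inside (path_image c)"
  shows "measure lebesgue (inside (path_image c)) = 1/2 * integral {0..1} (\<lambda>t. Im (cnj (c t - q) * c1 t))"
proof -
  define S where "S = {v :: real^2. v $ 1 \<in> {0<..<1} \<and> v $ 2 \<in> {0..<1}}"
  define D where "D = (\<lambda>t. Im (cnj (c t - q) * c1 t))"
  have D: "continuous_on UNIV D" unfolding D_def by (intro continuous_intros cont_c cont_c1)
  define g where "g = (\<lambda>v :: real^2. vec_of_complex (q + (v $ 1) *\<^sub>R (c (v $ 2) - q)))"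
  define g' where "g' = (\<lambda>(v :: real^2) (h :: real^2). vec_of_complex
      ((v $ 1) *\<^sub>R ((h $ 2) *\<^sub>R c1 (v $ 2)) + (h $ 1) *\<^sub>R (c (v $ 2) - q)))"
  have bl: "bounded_linear vec_of_complex" using linear_vec_of_complex by (simp add: linear_linear)
  have deriv: "(g has_derivative g' v) (at v within S)" for v :: "real^2"
  proof -
    have C: "((\<lambda>v. c (v $ 2)) has_derivative (\<lambda>h. (h $ 2) *\<^sub>R c1 (v $ 2))) (at v within S)"
      by (rule has_derivative_compose[of "\<lambda>v. v $ 2" "\<lambda>h. h $ 2"])
         (use c in \<open>auto simp: has_vector_derivative_def intro: bounded_linear_imp_has_derivative bounded_linear_vec_nth\<close>)
    have "((\<lambda>v. q + (v $ 1) *\<^sub>R (c (v $ 2) - q)) has_derivative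
       (\<lambda>h. (v $ 1) *\<^sub>R ((h $ 2) *\<^sub>R c1 (v $ 2)) + (h $ 1) *\<^sub>R (c (v $ 2) - q))) (at v within S)"
      by (auto intro!: derivative_eq_intros C bounded_linear_imp_has_derivative[OF bounded_linear_vec_nth])
    then show ?thesis unfolding g_def g'_def by (rule bounded_linear.has_derivative[OF bl])
  qed
  have det: "\<bar>det (matrix (g' v))\<bar> = v $ 1 * D (v $ 2)" if "v \<in> S" for v
  proof -
    have "det (matrix (g' v)) = v $ 1 * D (v $ 2)"
      by (simp add: det_2 matrix_def g'_def vec_of_complex_def axis_def D_def algebra_simps)
    then show ?thesis using that cross_product_pos[OF q, of "v $ 2"] by (simp add: S_def D_def)
  qed
  have inj: "inj_on g S"
  proof (rule inj_onI)
    fix v w assume v: "v \<in> S" "w \<in> S" "g v = g w"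
    then have "q + (v $ 1) *\<^sub>R (c (v $ 2) - q) = q + (w $ 1) *\<^sub>R (c (w $ 2) - q)"
      unfolding g_def by (metis complex_vec_inverse(1))
    then have "(v $ 1, v $ 2) = (w $ 1, w $ 2)"
      using inj_onD[OF star_parametrization_inj[OF q], of "(v $ 1, v $ 2)" "(w $ 1, w $ 2)"] v
      by (auto simp: S_def)
    then show "v = w" by (simp add: vec_eq_iff forall_2)
  qed
  note wedge = integral_wedge[OF D, folded S_def]
  have "measure lebesgue (g ` S) = integral S (\<lambda>v. \<bar>det (matrix (g' v))\<bar>)"
  proof (rule measure_differentiable_image_eq[OF wedge(1) deriv inj])
    show "(\<lambda>v. \<bar>det (matrix (g' v))\<bar>) integrable_on S"
      using wedge(2) by (rule integrable_eq) (simp add: det)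
  qed
  also have "\<dots> = integral S (\<lambda>v. v $ 1 * D (v $ 2))" by (rule integral_cong) (rule det)
  also have "\<dots> = 1/2 * integral {0..1} D" by (rule wedge(3))
  finally have m: "measure lebesgue (g ` S) = 1/2 * integral {0..1} D" .
  let ?I = "inside (path_image c)"
  have opI: "open ?I" using simple by (simp add: open_inside closed_path_image simple_path_imp_path)
  have pair: "S = (\<lambda>(r, t). vector [r, t]) ` ({0<..<1} \<times> {0..<1})"
  proof (intro equalityI subsetI)
    fix v assume "v \<in> S"
    moreover have "v = vector [v $ 1, v $ 2]" by (simp add: vec_eq_iff forall_2)
    ultimately show "v \<in> (\<lambda>(r, t). vector [r, t]) ` ({0<..<1} \<times> {0..<1})"
      by (intro image_eqI[of _ _ "(v $ 1, v $ 2)"]) (auto simp: S_def)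
  qed (auto simp: S_def)
  have gS: "g ` S = vec_of_complex ` (?I - {q})"
    unfolding inside_star_parametrization[OF q, symmetric] pair image_image
    by (intro image_cong) (auto simp: g_def)
  have im: "vec_of_complex ` T = complex_of_vec -` T" for T
    by (auto simp: image_iff) (erule bexI[rotated], simp)
  have inj_v: "inj vec_of_complex" by (rule injI) (metis complex_vec_inverse(1))
  have contv: "continuous_on A complex_of_vec" for A
    using linear_complex_of_vec by (intro linear_continuous_on) (simp add: linear_linear)
  have "open (complex_of_vec -` ?I)"
    using opI contv by (intro open_vimage)
  then have opv: "open (vec_of_complex ` ?I)" by (simp add: im)
  have [measurable]: "vec_of_complex \<in> borel \<rightarrow>\<^sub>M borel"
    using bl by (intro borel_measurable_continuous_onI linear_continuous_on)
  have "measure lebesgue ?I = measure lborel ?I" using opI by simp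
  also have "\<dots> = measure (distr lborel borel vec_of_complex) (vec_of_complex ` ?I)"
  proof -
    have "vec_of_complex -` (vec_of_complex ` ?I) = ?I"
      by (rule inj_vimage_image_eq[OF inj_v])
    then show ?thesis using opv by (simp add: measure_distr)
  qed
  also have "\<dots> = measure lebesgue (vec_of_complex ` ?I)"
    using opv by (simp add: distr_vec_of_complex)
  also have "vec_of_complex ` ?I = g ` S \<union> {vec_of_complex q}"
    unfolding gS using q by auto
  also have "measure lebesgue \<dots> = measure lebesgue (g ` S)"
  proof (rule measure_Un_null_set)
    have "vec_of_complex ` (?I - {q}) = vec_of_complex ` ?I - {vec_of_complex q}"
      using image_set_diff[OF inj_v, of ?I "{q}"] by simp
    then show "g ` S \<in> sets lebesgue" unfolding gS using opv by simp
  qed (simp add: negligible_iff_null_sets[symmetric])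
  finally show ?thesis using m by (simp add: D_def)
qed

text \<open>
As seen from an inside point the curve moves counterclockwise all the time.
\<close>

lemma winding_number_pos:
  assumes q: "q \<in> inside (path_image c)"
  shows "Re (winding_number c q) > 0"
proof -
  define D where "D = (\<lambda>t. Im (cnj (c t - q) * c1 t))"
  have "continuous_on {0..1} D" unfolding D_def by (intro continuous_intros cont_c cont_c1)
  then have "\<exists>t\<in>{0..1}. \<forall>s\<in>{0..1}. D t \<le> D s"
    by (intro continuous_attains_inf) auto
  then obtain t where t: "\<And>s. s \<in> {0..1} \<Longrightarrow> D t \<le> D s" by blast
  show ?thesis
  proof (rule winding_number_pos_lt[where e = "D t"])
    have "c C1_differentiable_on {0..1}"
      unfolding C1_differentiable_on_def using c cont_c1 by blast
    then show "valid_path c"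
      by (simp add: valid_path_def C1_differentiable_imp_piecewise)
    show "q \<notin> path_image c" using q inside_no_overlap[of "path_image c"] by blast
    show "D t > 0" unfolding D_def by (rule cross_product_pos[OF q])
    show "D t \<le> Im (vector_derivative c (at x) * cnj (c x - q))" if "0 < x" "x < 1" for x
      using t[of x] that vector_derivative_at[OF c[of x]] by (simp add: D_def mult.commute)
  qed
qed

end


section \<open>Support function, equidistants and width of the curve\<close>

lemma setdist_parallel_hyperplanes:
  fixes u :: "'a::euclidean_space"
  assumes "norm u = 1"
  shows "setdist {z. inner u z = a} {z. inner u z = b} = \<bar>a - b\<bar>"
proof (rule antisym)
  have uu: "inner u u = 1" using assms by (simp add: norm_eq_1)
  have mem: "a *\<^sub>R u \<in> {z. inner u z = a}" "b *\<^sub>R u \<in> {z. inner u z = b}" by (simp_all add: uu)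
  have "setdist {z. inner u z = a} {z. inner u z = b} \<le> dist (a *\<^sub>R u) (b *\<^sub>R u)"
    using mem by (rule setdist_le_dist)
  also have "\<dots> = \<bar>a - b\<bar>"
    using assms by (simp add: dist_norm flip: scaleR_diff_left)
  finally show "setdist {z. inner u z = a} {z. inner u z = b} \<le> \<bar>a - b\<bar>" .
  show "\<bar>a - b\<bar> \<le> setdist {z. inner u z = a} {z. inner u z = b}"
  proof (rule le_setdistI)
    show "{z. inner u z = a} \<noteq> {}" "{z. inner u z = b} \<noteq> {}" using mem by blast+
    fix x y assume "x \<in> {z. inner u z = a}" "y \<in> {z. inner u z = b}"
    then have "\<bar>a - b\<bar> = \<bar>inner u (x - y)\<bar>" by (simp add: inner_diff_right)
    also have "\<dots> \<le> norm u * norm (x - y)" by (rule Cauchy_Schwarz_ineq2)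
    finally show "\<bar>a - b\<bar> \<le> dist x y" using assms by (simp add: dist_norm)
  qed
qed

lemma cos_sin_unit:
  "cos x * (cos x * z) + sin x * (sin x * z) = (z :: real)"
  "z * (cos x * cos x) + z * (sin x * sin x) = (z :: real)"
proof -
  show "z * (cos x * cos x) + z * (sin x * sin x) = z"
    by (simp flip: distrib_left)
  then show "cos x * (cos x * z) + sin x * (sin x * z) = z"
    by (simp only: mult_ac)
qed

context normal_parametrized_loop
begin

text \<open>
The derivative of the support function is the component of the position vector in tangent
direction, since moving the curve point along its tangent does not change the height.
\<close>

definition supp :: "complex \<Rightarrow> real \<Rightarrow> real" where
  "supp q x = inner (c (\<tau> x) - q) (cis x)"

definition supp' :: "complex \<Rightarrow> real \<Rightarrow> real" where
  "supp' q x = inner (c (\<tau> x) - q) (\<i> * cis x)"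

lemma velocity_at: "vector_derivative c (at t) = c1 t" "vector_derivative c1 (at t) = c2 t"
  using c c1 by (auto intro!: vector_derivative_at)

lemma supp_derivatives:
  "(supp q has_real_derivative supp' q x) (at x)"
  "(supp' q has_real_derivative \<rho> x - supp q x) (at x)"
proof -
  define X where "X = (\<lambda>x. Re (c (\<tau> x)))"
  define Y where "Y = (\<lambda>x. Im (c (\<tau> x)))"
  have X: "(X has_real_derivative - (\<rho> x * sin x)) (at x)"
    and Y: "(Y has_real_derivative \<rho> x * cos x) (at x)"
    using vector_derivative_Re_Im[OF point_derivative[of x]] by (simp_all add: X_def Y_def)
  have supp: "supp q = (\<lambda>x. (X x - Re q) * cos x + (Y x - Im q) * sin x)"
    and supp': "supp' q = (\<lambda>x. (Y x - Im q) * cos x - (X x - Re q) * sin x)"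
    by (auto simp: supp_def supp'_def X_def Y_def inner_complex_def)
  show "(supp q has_real_derivative supp' q x) (at x)"
    unfolding supp supp' by (auto intro!: derivative_eq_intros X Y simp: algebra_simps)
  show "(supp' q has_real_derivative \<rho> x - supp q x) (at x)"
    unfolding supp supp'
    by (rule derivative_eq_intros X Y refl)+ (simp add: algebra_simps cos_sin_unit)
qed

lemma supp_per: "supp q (x + 2 * pi) = supp q x"
  by (simp add: supp_def \<tau>_turn per inner_complex_def)

lemma support_profile_supp: "support_profile (supp q) (supp' q) (\<lambda>x. \<rho> x - supp q x)"
proof
  show "continuous_on UNIV (\<lambda>x. \<rho> x - supp q x)"
    by (intro continuous_intros cont_\<rho> continuous_at_imp_continuous_on ballI
        DERIV_isCont[OF supp_derivatives(1)])
qed (simp_all add: supp_derivatives supp_per \<rho>_per)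

lemma supp_pos: "q \<in> inside (path_image c) \<Longrightarrow> supp q x > 0"
  using inside_below_tangent[of q x] by (simp add: supp_def inner_diff_left)

lemma support_function_eq: "support_function c q = supp q"
proof
  fix \<theta>
  have vel: "velocity c (\<tau> \<theta>) = norm (c1 (\<tau> \<theta>)) *\<^sub>R (\<i> * cis \<theta>)"
    unfolding velocity_at by (rule normal)
  have ex: "outer_normal c (\<tau> \<theta>) (cis \<theta>)"
    unfolding outer_normal_def
  proof (intro conjI ballI)
    show "inner (velocity c (\<tau> \<theta>)) (cis \<theta>) = 0"
      unfolding vel by (simp add: inner_complex_def)
    show "inner (x - c (\<tau> \<theta>)) (cis \<theta>) \<le> 0" if "x \<in> path_image c" for x
      using that below_tangent by (auto simp: path_image_c)
  qed simp
  have uniq: "inner (c t - q) (cis \<theta>) = supp q \<theta>" if "outer_normal c t (cis \<theta>)" for t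
  proof -
    have "inner (c (\<tau> \<theta>) - c t) (cis \<theta>) \<le> 0" using that by (simp add: outer_normal_def path_image_c)
    with below_tangent[of t \<theta>] show ?thesis by (simp add: supp_def inner_diff_left)
  qed
  show "support_function c q \<theta> = supp q \<theta>"
    unfolding support_function_def
  proof (rule the_equality)
    show "\<exists>t. outer_normal c t (cis \<theta>) \<and> supp q \<theta> = inner (c t - q) (cis \<theta>)"
      using ex uniq by metis
    show "h = supp q \<theta>" if "\<exists>t. outer_normal c t (cis \<theta>) \<and> h = inner (c t - q) (cis \<theta>)" for h
      using that uniq by blast
  qed
qed

text \<open>
The classical parametrization by \<open>p\<close> and \<open>p'\<close> resolves the position vector in the orthonormal
frame of normal and tangent, so it returns the curve itself.
\<close>

lemma support_param_eq: "support_param c q x = c (\<tau> x) - q"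
proof -
  have d: "deriv (supp q) x = supp' q x" by (rule DERIV_imp_deriv[OF supp_derivatives(1)])
  show ?thesis
    unfolding support_param_def Let_def support_function_eq d
    by (simp add: complex_eq_iff supp_def supp'_def inner_complex_def algebra_simps cos_sin_unit)
qed

lemma equidistant_velocity:
  "velocity (equidistant_param c q l) x = (l * \<rho> x - (1 - l) * \<rho> (x + pi)) *\<^sub>R (\<i> * cis x)"
proof -
  have "((\<lambda>x. c (\<tau> (x + pi))) has_vector_derivative \<rho> (x + pi) *\<^sub>R (\<i> * cis (x + pi))) (at x)"
    by (rule has_vector_derivative_shift[of "\<lambda>x. c (\<tau> x)", OF point_derivative])
  moreover have "cis (x + pi) = - cis x" by (simp add: complex_eq_iff)
  ultimately have opp: "((\<lambda>x. c (\<tau> (x + pi))) has_vector_derivative - (\<rho> (x + pi) *\<^sub>R (\<i> * cis x))) (at x)"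
    by simp
  have "((\<lambda>x. l *\<^sub>R (c (\<tau> x) - q) + (1 - l) *\<^sub>R (c (\<tau> (x + pi)) - q)) has_vector_derivative
      l *\<^sub>R (\<rho> x *\<^sub>R (\<i> * cis x) - 0) + (1 - l) *\<^sub>R (- (\<rho> (x + pi) *\<^sub>R (\<i> * cis x)) - 0)) (at x)"
    by (intro has_vector_derivative_add bounded_linear.has_vector_derivative[OF bounded_linear_scaleR_right]
        has_vector_derivative_diff has_vector_derivative_const point_derivative opp)
  then have "velocity (\<lambda>x. l *\<^sub>R (c (\<tau> x) - q) + (1 - l) *\<^sub>R (c (\<tau> (x + pi)) - q)) x
      = l *\<^sub>R (\<rho> x *\<^sub>R (\<i> * cis x) - 0) + (1 - l) *\<^sub>R (- (\<rho> (x + pi) *\<^sub>R (\<i> * cis x)) - 0)"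
    by (rule vector_derivative_at)
  then show ?thesis
    by (simp add: equidistant_param_def[abs_def] support_param_eq algebra_simps)
qed

text \<open>
The velocity of the equidistant is tangent to \<open>c\<close> at the same normal angle, so the area
integrand is the product of its own support function and its signed radius of curvature.
\<close>

lemma equidistant_area_supp:
  "equidistant_area c q l = 1/2 * integral {0..(if l = 1/2 then pi else 2 * pi)}
     (\<lambda>x. (l * supp q x - (1 - l) * supp q (x + pi)) *
        ((l * supp q x - (1 - l) * supp q (x + pi))
          + (l * (\<rho> x - supp q x) - (1 - l) * (\<rho> (x + pi) - supp q (x + pi)))))"
proof -
  have "Re (equidistant_param c q l x) * Im (velocity (equidistant_param c q l) x) -
      Im (equidistant_param c q l x) * Re (velocity (equidistant_param c q l) x)
    = (l * supp q x - (1 - l) * supp q (x + pi)) *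
        ((l * supp q x - (1 - l) * supp q (x + pi))
          + (l * (\<rho> x - supp q x) - (1 - l) * (\<rho> (x + pi) - supp q (x + pi))))" for x
  proof -
    have h: "l * supp q x - (1 - l) * supp q (x + pi)
        = Re (equidistant_param c q l x) * cos x + Im (equidistant_param c q l x) * sin x"
      by (simp add: equidistant_param_def support_param_eq supp_def inner_complex_def algebra_simps)
    have r: "(l * supp q x - (1 - l) * supp q (x + pi))
          + (l * (\<rho> x - supp q x) - (1 - l) * (\<rho> (x + pi) - supp q (x + pi)))
        = l * \<rho> x - (1 - l) * \<rho> (x + pi)"
      by (simp add: algebra_simps)
    show ?thesis unfolding r unfolding h equidistant_velocity by (simp add: algebra_simps)
  qed
  then show ?thesis unfolding equidistant_area_def Let_def by simp
qed

text \<open>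
Cauchy's formula: the radius of curvature \<open>p + p''\<close> integrates to the length, and \<open>p''\<close> has
integral zero over a period.
\<close>

lemma length_supp: "curve_length c = integral {0..2*pi} (supp q)"
proof -
  interpret support_profile "supp q" "supp' q" "\<lambda>x. \<rho> x - supp q x" by (rule support_profile_supp)
  have "((\<lambda>x. \<rho> x - supp q x) has_integral (supp' q (2*pi) - supp' q 0)) {0..2*pi}"
    by (rule fundamental_theorem_of_calculus)
       (auto simp: has_real_derivative_iff_has_vector_derivative[symmetric]
          intro: has_field_derivative_at_within p1)
  moreover have "supp' q (2*pi) = supp' q 0" using p1_per[of 0] by simp
  ultimately have "integral {0..2*pi} (\<lambda>x. \<rho> x - supp q x) = 0" by (simp add: integral_unique)
  then have "integral {0..2*pi} \<rho> = integral {0..2*pi} (supp q)"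
    by (simp add: integral_diff integrable_continuous_real cont_\<rho> cont_p)
  then show ?thesis by (simp add: curve_length_def velocity_at length_eq)
qed

lemma area_supp:
  assumes "q \<in> inside (path_image c)"
  shows "enclosed_area c = 1/2 * integral {0..2*pi} (\<lambda>x. supp q x * \<rho> x)"
proof -
  have "integral {0..2*pi} (\<lambda>x. Im (cnj (c (\<tau> x) - q) * c1 (\<tau> x)) * \<tau>' x)
      = integral {0..1} (\<lambda>t. Im (cnj (c t - q) * c1 t))"
    by (rule integral_over_normals[of "\<lambda>t. Im (cnj (c t - q) * c1 t)"])
       (auto intro!: continuous_intros cont_c cont_c1 simp: per per1)
  moreover have "Im (cnj (c (\<tau> x) - q) * c1 (\<tau> x)) * \<tau>' x = supp q x * \<rho> x" for x
    unfolding cross_product_at_normal by (simp add: supp_def \<rho>_def)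
  ultimately show ?thesis
    unfolding enclosed_area_def area_eq[OF assms] by simp
qed

lemma tangent_line_eq:
  "tangent_line c (\<tau> x) = {z. inner (cis x) z = supp q x + inner (cis x) q}"
proof (intro equalityI subsetI)
  fix z assume "z \<in> tangent_line c (\<tau> x)"
  then obtain s where "z = c (\<tau> x) + s *\<^sub>R c1 (\<tau> x)"
    by (auto simp: tangent_line_def velocity_at)
  moreover have "inner (cis x) (c1 (\<tau> x)) = 0"
    by (subst normal) (simp add: inner_complex_def)
  ultimately show "z \<in> {z. inner (cis x) z = supp q x + inner (cis x) q}"
    by (simp add: supp_def inner_add_right inner_diff_right inner_commute[of _ "cis x"])
next
  fix z assume "z \<in> {z. inner (cis x) z = supp q x + inner (cis x) q}"
  then have z: "inner (cis x) (z - c (\<tau> x)) = 0"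
    by (simp add: supp_def inner_diff_right inner_diff_left inner_commute)
  define w where "w = z - c (\<tau> x)"
  define s where "s = inner (\<i> * cis x) w"
  have w: "w = s *\<^sub>R (\<i> * cis x)"
  proof -
    have "w = inner (cis x) w *\<^sub>R cis x + s *\<^sub>R (\<i> * cis x)"
      by (simp add: complex_eq_iff s_def inner_complex_def algebra_simps cos_sin_unit)
    then show ?thesis using z by (simp add: w_def)
  qed
  have "z = c (\<tau> x) + (s / norm (c1 (\<tau> x))) *\<^sub>R (norm (c1 (\<tau> x)) *\<^sub>R (\<i> * cis x))"
    using w regular[of "\<tau> x"] by (simp add: w_def algebra_simps)
  then have "z = c (\<tau> x) + (s / norm (c1 (\<tau> x))) *\<^sub>R c1 (\<tau> x)" by (simp only: normal[symmetric])
  then show "z \<in> tangent_line c (\<tau> x)" unfolding tangent_line_def velocity_at by blast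
qed

lemma opposite_tangent_line:
  "tangent_line c (\<tau> (x + pi)) = {z. inner (cis x) z = - supp q (x + pi) + inner (cis x) q}"
proof -
  have "cis (x + pi) = - cis x" by (simp add: complex_eq_iff)
  then show ?thesis unfolding tangent_line_eq[of "x + pi" q] by auto
qed

lemma setdist_opposite_tangents:
  assumes "q \<in> inside (path_image c)"
  shows "setdist (tangent_line c (\<tau> x)) (tangent_line c (\<tau> (x + pi))) = supp q x + supp q (x + pi)"
proof -
  have "setdist (tangent_line c (\<tau> x)) (tangent_line c (\<tau> (x + pi)))
      = \<bar>(supp q x + inner (cis x) q) - (- supp q (x + pi) + inner (cis x) q)\<bar>"
    unfolding tangent_line_eq[of x q] opposite_tangent_line[of x q]
    by (rule setdist_parallel_hyperplanes) simp
  also have "\<dots> = supp q x + supp q (x + pi)"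
    using supp_pos[OF assms, of x] supp_pos[OF assms, of "x + pi"] by linarith
  finally show ?thesis .
qed

text \<open>
Velocities at normal angles \<open>x\<close> and \<open>y\<close> are parallel iff \<open>y - x\<close> is a multiple of \<open>pi\<close>.  Even
multiples give the same tangent line and odd multiples the opposite one, whose distance is the sum
of the two support values because \<open>q\<close> lies between the lines.
\<close>

lemma constant_width_iff:
  assumes q: "q \<in> inside (path_image c)"
  shows "constant_width c \<longleftrightarrow> (\<exists>w. \<forall>x. supp q x + supp q (x + pi) = w)"
proof
  assume "constant_width c"
  then obtain w where w: "\<forall>s t. collinear {0, velocity c s, velocity c t} \<and>
      tangent_line c s \<noteq> tangent_line c t \<longrightarrow> setdist (tangent_line c s) (tangent_line c t) = w"
    unfolding constant_width_def by (rule exE)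
  have "supp q x + supp q (x + pi) = w" for x
  proof -
    define k where "k = - (norm (c1 (\<tau> (x + pi))) / norm (c1 (\<tau> x)))"
    have "c1 (\<tau> (x + pi)) = norm (c1 (\<tau> (x + pi))) *\<^sub>R (- (\<i> * cis x))"
      by (subst normal) (simp add: complex_eq_iff)
    also have "\<dots> = k *\<^sub>R (norm (c1 (\<tau> x)) *\<^sub>R (\<i> * cis x))"
      using regular[of "\<tau> x"] by (simp add: k_def)
    finally have "c1 (\<tau> (x + pi)) = k *\<^sub>R c1 (\<tau> x)" by (simp only: normal[symmetric])
    then have "collinear {0, velocity c (\<tau> x), velocity c (\<tau> (x + pi))}"
      unfolding velocity_at collinear_lemma by blast
    moreover have "tangent_line c (\<tau> x) \<noteq> tangent_line c (\<tau> (x + pi))"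
    proof
      assume eq: "tangent_line c (\<tau> x) = tangent_line c (\<tau> (x + pi))"
      have "c (\<tau> x) \<in> tangent_line c (\<tau> x)"
        by (simp add: tangent_line_eq[of x q] supp_def inner_diff_right inner_commute[of _ "cis x"])
      moreover from this have "c (\<tau> x) \<in> tangent_line c (\<tau> (x + pi))" unfolding eq .
      ultimately show False
        using supp_pos[OF q, of x] supp_pos[OF q, of "x + pi"]
        unfolding tangent_line_eq[of x q] opposite_tangent_line[of x q] by auto
    qed
    ultimately have "setdist (tangent_line c (\<tau> x)) (tangent_line c (\<tau> (x + pi))) = w"
      by (intro w[rule_format] conjI)
    then show ?thesis by (simp only: setdist_opposite_tangents[OF q])
  qed
  then show "\<exists>w. \<forall>x. supp q x + supp q (x + pi) = w" by blast
next
  assume "\<exists>w. \<forall>x. supp q x + supp q (x + pi) = w"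
  then obtain w where w: "\<And>x. supp q x + supp q (x + pi) = w" by blast
  show "constant_width c"
    unfolding constant_width_def
  proof (intro exI[of _ w] allI impI, elim conjE)
    fix s t assume col: "collinear {0, velocity c s, velocity c t}"
      and ne: "tangent_line c s \<noteq> tangent_line c t"
    obtain x y where xy: "s = \<tau> x" "t = \<tau> y" using \<tau>_surj by (metis surjD)
    have line_per: "tangent_line c (\<tau> (x + 2 * pi)) = tangent_line c (\<tau> x)" for x
      by (simp add: tangent_line_eq[of _ q] supp_per) (simp add: inner_complex_def)
    have line_int: "tangent_line c (\<tau> (x + of_int k * (2 * pi))) = tangent_line c (\<tau> x)" for x and k :: int
      by (rule periodic_int_multiple[of "\<lambda>x. tangent_line c (\<tau> x)"]) (rule line_per)
    obtain k where "c1 t = k *\<^sub>R c1 s"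
      using col regular unfolding velocity_at collinear_lemma by blast
    then have "norm (c1 t) *\<^sub>R (\<i> * cis y) = k *\<^sub>R (norm (c1 s) *\<^sub>R (\<i> * cis x))"
      using normal[of x] normal[of y] by (simp only: xy)
    then have "inner (norm (c1 t) *\<^sub>R (\<i> * cis y)) (cis x) = inner (k *\<^sub>R (norm (c1 s) *\<^sub>R (\<i> * cis x))) (cis x)"
      by simp
    then have "norm (c1 t) * sin (y - x) = 0"
      by (auto simp: inner_complex_def sin_diff algebra_simps)
    then have "sin (y - x) = 0" using regular by simp
    then obtain n :: int where n: "y = x + of_int n * pi"
      unfolding sin_zero_iff_int2 by (auto simp: algebra_simps)
    show "setdist (tangent_line c s) (tangent_line c t) = w"
    proof (cases "even n")
      case True
      then obtain m where "n = 2 * m" by blast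
      then have "y = x + of_int m * (2 * pi)" using n by simp
      then show ?thesis using ne line_int[of x m] by (simp add: xy)
    next
      case False
      then obtain m where "n = 2 * m + 1" by (rule oddE)
      then have "y = (x + pi) + of_int m * (2 * pi)" using n by (simp add: algebra_simps)
      then have "tangent_line c t = tangent_line c (\<tau> (x + pi))"
        using line_int[of "x + pi" m] by (simp add: xy)
      then show ?thesis using setdist_opposite_tangents[OF q, of x] w by (simp add: xy)
    qed
  qed
qed

text \<open>
All five statements are read off from this splitting of the area.  With \<open>l = 1\<close> the equidistant is
the curve itself, which gives the enclosed area; for \<open>l = 1/2\<close> the even part drops out.
\<close>

lemma area_decomposition:
  assumes q: "q \<in> inside (path_image c)"
  obtains E N :: real
  where "enclosed_area c = E + N"
    "\<And>l. l \<noteq> 1/2 \<Longrightarrow> equidistant_area c q l = (2 * l - 1)\<^sup>2 * E + N"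
    "2 * equidistant_area c q (1/2) = N"
    "N \<le> 0" "E \<le> (curve_length c)\<^sup>2 / (4 * pi)"
    "constant_width c \<longleftrightarrow> E = (curve_length c)\<^sup>2 / (4 * pi)"
proof -
  interpret support_profile "supp q" "supp' q" "\<lambda>x. \<rho> x - supp q x" by (rule support_profile_supp)
  show thesis
  proof (rule that)
    show "enclosed_area c = even_area + odd_area"
      using equidistant_integral[of 1] by (simp add: area_supp[OF q])
    show "equidistant_area c q l = (2 * l - 1)\<^sup>2 * even_area + odd_area" if "l \<noteq> 1/2" for l
      using equidistant_integral[of l] that by (simp add: equidistant_area_supp)
    show "2 * equidistant_area c q (1/2) = odd_area"
      using wigner_integral by (simp add: equidistant_area_supp)
    show "odd_area \<le> 0" by (rule odd_area_nonpos)
    show "even_area \<le> (curve_length c)\<^sup>2 / (4 * pi)"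
      using even_area_bound(1) by (simp add: length_supp[of q])
    show "constant_width c \<longleftrightarrow> even_area = (curve_length c)\<^sup>2 / (4 * pi)"
      using even_area_bound(2) constant_width_iff[OF q] by (simp add: length_supp[of q])
  qed
qed

end

section \<open>Areas of the affine equidistants of an oval\<close>

lemma smooth_curve_derivatives:
  assumes "smooth_curve c"
  shows "(c has_vector_derivative velocity c t) (at t)"
    "(velocity c has_vector_derivative velocity (velocity c) t) (at t)"
    "continuous_on UNIV (velocity (velocity c))"
proof -
  have d: "(velocity ^^ k) c differentiable (at t)" for k t
    using assms by (simp add: smooth_curve_def)
  show "(c has_vector_derivative velocity c t) (at t)"
    using d[of 0 t] by (simp add: vector_derivative_works)
  show "(velocity c has_vector_derivative velocity (velocity c) t) (at t)"
    using d[of 1 t] by (simp add: vector_derivative_works)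
  show "continuous_on UNIV (velocity (velocity c))"
    using d[of 2] by (intro continuous_at_imp_continuous_on ballI)
      (simp add: numeral_2_eq_2 differentiable_imp_continuous_within)
qed

text \<open>
If the curvature were negative, the reversed curve would have positive curvature and hence positive
winding number around the inside point \<open>q\<close>; so the original curve would be negatively oriented.
\<close>

lemma positively_oriented_oval_convex_loop:
  assumes "oval c" "positively_oriented c" and q: "q \<in> inside (path_image c)"
  shows "convex_loop c (velocity c) (velocity (velocity c))"
proof -
  have smooth: "smooth_curve c" and reg: "velocity c t \<noteq> 0" and per: "c (t + 1) = c t"
    and simple_c: "simple_path c" for t
    using assms(1) by (auto simp: oval_def)
  note d = smooth_curve_derivatives[OF smooth]
  have curv: "signed_curvature c t * norm (velocity c t) ^ 3
      = Im (cnj (velocity c t) * velocity (velocity c) t)" for t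
    using reg[of t] by (simp add: signed_curvature_def)
  have npos: "norm (velocity c t) ^ 3 > 0" for t using reg by simp
  have "\<not> (\<forall>t. signed_curvature c t < 0)"
  proof
    assume neg: "\<forall>t. signed_curvature c t < 0"
    define b where "b = (\<lambda>t. c (1 - t))"
    have b_rev: "b = reversepath c" by (simp add: b_def reversepath_def[abs_def])
    have flip: "((\<lambda>t. f (1 - t)) has_vector_derivative - f' (1 - t)) (at t)"
      if "\<And>t. (f has_vector_derivative f' t) (at t)" for f f' :: "real \<Rightarrow> complex" and t
    proof -
      have "(f \<circ> (\<lambda>t. 1 - t) has_vector_derivative (-1) *\<^sub>R f' (1 - t)) (at t)"
        by (rule vector_diff_chain_at)
           (auto intro!: derivative_eq_intros that
             simp: has_real_derivative_iff_has_vector_derivative[symmetric])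
      then show ?thesis by (simp add: o_def)
    qed
    interpret convex_loop b "\<lambda>t. - velocity c (1 - t)" "\<lambda>t. velocity (velocity c) (1 - t)"
    proof
      fix t :: real
      show "(b has_vector_derivative - velocity c (1 - t)) (at t)" unfolding b_def by (rule flip[OF d(1)])
      show "((\<lambda>t. - velocity c (1 - t)) has_vector_derivative velocity (velocity c) (1 - t)) (at t)"
        using has_vector_derivative_minus[OF flip[OF d(2), of t]] by simp
      show "continuous_on UNIV (\<lambda>t. velocity (velocity c) (1 - t))"
        by (rule continuous_on_compose2[OF d(3)]) (auto intro: continuous_intros)
      show "b (t + 1) = b t" using per[of "- t"] by (simp add: b_def)
      show "simple_path b" unfolding b_rev using simple_c by (simp add: simple_path_reversepath)
      have "signed_curvature c (1 - t) * norm (velocity c (1 - t)) ^ 3 < 0"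
        using neg npos by (simp add: mult_neg_pos)
      then show "0 < Im (cnj (- velocity c (1 - t)) * velocity (velocity c) (1 - t))"
        unfolding curv by simp
    qed
    obtain \<tau> \<tau>' where "normal_parametrized_loop b (\<lambda>t. - velocity c (1 - t))
        (\<lambda>t. velocity (velocity c) (1 - t)) \<tau> \<tau>'"
      by (rule ex_normal_parametrized_loop)
    then interpret R: normal_parametrized_loop b "\<lambda>t. - velocity c (1 - t)" "\<lambda>t. velocity (velocity c) (1 - t)" \<tau> \<tau>' .
    have "Re (winding_number b q) > 0"
      by (rule R.winding_number_pos) (use q in \<open>simp add: b_rev\<close>)
    moreover have "winding_number b q = - winding_number c q"
      unfolding b_rev
    proof (rule winding_number_reversepath)
      show "path c" by (rule simple_path_imp_path[OF simple_c])
      show "q \<notin> path_image c" using q inside_no_overlap[of "path_image c"] by blast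
    qed
    moreover have "winding_number c q = 1" using assms by (simp add: positively_oriented_def)
    ultimately show False by simp
  qed
  then have pos: "signed_curvature c t > 0" for t using assms(1) by (auto simp: oval_def)
  show ?thesis
  proof
    show "Im (cnj (velocity c t) * velocity (velocity c) t) > 0" for t
      unfolding curv[symmetric] using pos npos by simp
  qed (use d per simple_c in auto)
qed

theorem theorem3p2:
  fixes c :: "real \<Rightarrow> complex" and q :: complex
  assumes "oval c" and "positively_oriented c"
    and "q \<in> inside (path_image c)"
  defines "A \<equiv> enclosed_area c" and "L \<equiv> curve_length c" and "AT \<equiv> equidistant_area c q"
  shows
    "(\<forall>l \<in> {0<..<1/2} \<union> {1/2<..<1}.
        A - l * (1 - l) / pi * L\<^sup>2 \<le> AT l \<and> AT l \<le> (2 * l - 1)\<^sup>2 * A) \<and>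
     (A - L\<^sup>2 / (4 * pi) \<le> 2 * AT (1/2) \<and> 2 * AT (1/2) \<le> 0) \<and>
     (\<forall>l \<in> {..<0} \<union> {1<..}.
        (2 * l - 1)\<^sup>2 * A \<le> AT l \<and> AT l \<le> A - l * (1 - l) / pi * L\<^sup>2) \<and>
     (\<forall>l \<in> - {0, 1/2, 1}.
        constant_width c \<longleftrightarrow> AT l = A - l * (1 - l) / pi * L\<^sup>2) \<and>
     (constant_width c \<longleftrightarrow> 2 * AT (1/2) = A - L\<^sup>2 / (4 * pi))"
proof -
  interpret convex_loop c "velocity c" "velocity (velocity c)"
    by (rule positively_oriented_oval_convex_loop[OF assms(1-3)])
  obtain \<tau> \<tau>' where "normal_parametrized_loop c (velocity c) (velocity (velocity c)) \<tau> \<tau>'"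
    by (rule ex_normal_parametrized_loop)
  then interpret normal_parametrized_loop c "velocity c" "velocity (velocity c)" \<tau> \<tau>' .
  obtain E N where EN: "A = E + N" "\<And>l. l \<noteq> 1/2 \<Longrightarrow> AT l = (2 * l - 1)\<^sup>2 * E + N"
    "2 * AT (1/2) = N" "N \<le> 0" and E: "E \<le> L\<^sup>2 / (4 * pi)"
    and cw: "constant_width c \<longleftrightarrow> E = L\<^sup>2 / (4 * pi)"
    unfolding A_def L_def AT_def using area_decomposition[OF assms(3)] by metis
  define X where "X = L\<^sup>2 / (4 * pi)"
  have X: "l * (1 - l) / pi * L\<^sup>2 = 4 * (l * (1 - l)) * X" for l
    by (simp add: X_def)
  have sq: "(2 * l - 1)\<^sup>2 = 1 - 4 * (l * (1 - l))" for l :: real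
    by (simp add: power2_eq_square algebra_simps)
  have lower: "AT l - (A - l * (1 - l) / pi * L\<^sup>2) = 4 * (l * (1 - l)) * (X - E)" if "l \<noteq> 1/2" for l
    unfolding EN(1) EN(2)[OF that] X sq by (simp add: algebra_simps)
  have upper: "(2 * l - 1)\<^sup>2 * A - AT l = - (4 * (l * (1 - l)) * N)" if "l \<noteq> 1/2" for l
    unfolding EN(1) EN(2)[OF that] sq by (simp add: algebra_simps)
  have XE: "X - E \<ge> 0" using E by (simp add: X_def)
  show ?thesis
  proof (intro conjI ballI)
    fix l :: real assume l: "l \<in> {0<..<1/2} \<union> {1/2<..<1}"
    then have ll: "l * (1 - l) \<ge> 0" and ne: "l \<noteq> 1/2" by auto
    show "A - l * (1 - l) / pi * L\<^sup>2 \<le> AT l"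
      using lower[OF ne] mult_nonneg_nonneg[of "4 * (l * (1 - l))" "X - E"] ll XE by linarith
    show "AT l \<le> (2 * l - 1)\<^sup>2 * A"
      using upper[OF ne] mult_nonneg_nonpos[of "4 * (l * (1 - l))" N] ll EN(4) by linarith
  next
    fix l :: real assume l: "l \<in> {..<0} \<union> {1<..}"
    then have ll: "l * (1 - l) \<le> 0" and ne: "l \<noteq> 1/2" by (auto simp: mult_le_0_iff)
    show "(2 * l - 1)\<^sup>2 * A \<le> AT l"
      using upper[OF ne] mult_nonpos_nonpos[of "4 * (l * (1 - l))" N] ll EN(4) by linarith
    show "AT l \<le> A - l * (1 - l) / pi * L\<^sup>2"
      using lower[OF ne] mult_nonpos_nonneg[of "4 * (l * (1 - l))" "X - E"] ll XE by linarith
  next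
    fix l :: real assume l: "l \<in> - {0, 1/2, 1}"
    then have ll: "4 * (l * (1 - l)) \<noteq> 0" and ne: "l \<noteq> 1/2" by auto
    have "AT l = A - l * (1 - l) / pi * L\<^sup>2 \<longleftrightarrow> 4 * (l * (1 - l)) * (X - E) = 0"
      using lower[OF ne] by linarith
    also have "\<dots> \<longleftrightarrow> E = X" using ll by auto
    finally show "constant_width c \<longleftrightarrow> AT l = A - l * (1 - l) / pi * L\<^sup>2"
      using cw by (simp add: X_def)
  next
    show "A - L\<^sup>2 / (4 * pi) \<le> 2 * AT (1/2)" using EN E by simp
    show "2 * AT (1/2) \<le> 0" using EN by simp
    show "constant_width c \<longleftrightarrow> 2 * AT (1/2) = A - L\<^sup>2 / (4 * pi)" using EN cw by auto
  qed
qed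

end
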